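(* For every $0\le r<\pi$, $$\Lambda(r)=\begin{cases}1,&0\le r\le\pi/2,\\ +\infty,&\pi/2<r<\pi.\end{cases}$$ In the first range, more precisely, $B_r(k)=k$ for all integers $k\ge1$ and all $0\le r\le\tfrac\pi2$.
   Context: For $m\ge1$, $\mathbb S^m\subset\mathbb R^{m+1}$ is the unit round sphere with geodesic metric $\arccos\langle x,x'\rangle$; $\mathbb S^0$ is two points at distance $\pi$. The group $C_2$ of order two acts antipodally on each sphere; a map between $C_2$-spaces is odd if it is $C_2$-equivariant. The coindex of a $C_2$-space $X$ is $\mathrm{coind}(X):=\sup\{k\ge0:\text{there is a continuous odd map }\mathbb S^k\to X\}$. $\mathrm{VR}(X;r)$ is the geometric realization of the simplicial complex with vertex set $X$ whose simplices are the nonempty finite subsets of diameter at most $r$; $\mathrm{VR}(\mathbb S^m;r)$ carries the $C_2$-action induced by the antipodal map. For integers $0\le m\le n$, $c_{m,n}:=\inf\{r\ge0:\mathrm{coind}(\mathrm{VR}(\mathbb S^m;r))\ge n\}$. For $0\le r<\pi$ and an integer $k\ge1$, $B_r(k):=\max\{\ell\ge k:\ c_{k-1,\ell-1}\le r\}$ (a well-defined finite maximum), and $\Lambda(r):=\lim_{k\to\infty}B_r(k)/k\in[1,+\infty]$, a limit which exists because $B_r$ is superadditive. *)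

theory Defs
  imports "HOL-Analysis.Analysis" "HOL-Library.Extended_Nat"
begin

text \<open>
  A simplicial complex is given by its set of (finite, nonempty) simplices. Points of its
  geometric realization are families of barycentric coordinates \<open>t :: 'a \<Rightarrow> real\<close>.
\<close>

definition closed_simplex :: "'a set \<Rightarrow> ('a \<Rightarrow> real) set" where
  "closed_simplex \<sigma> = {t. (\<forall>v. 0 \<le> t v) \<and> (\<forall>v. v \<notin> \<sigma> \<longrightarrow> t v = 0) \<and> (\<Sum>v\<in>\<sigma>. t v) = 1}"

definition realization_carrier :: "'a set set \<Rightarrow> ('a \<Rightarrow> real) set" where
  "realization_carrier K = (\<Union>\<sigma>\<in>K. closed_simplex \<sigma>)"

text \<open>
  The realization carries the weak topology: a set is open iff its trace on every
  closed simplex is open there. On a closed simplex with finitely many vertices the product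
  topology used below is the usual Euclidean one.
\<close>

definition weakly_open :: "'a set set \<Rightarrow> ('a \<Rightarrow> real) set \<Rightarrow> bool" where
  "weakly_open K U \<longleftrightarrow> U \<subseteq> realization_carrier K \<and>
     (\<forall>\<sigma>\<in>K. openin (subtopology (powertop_real UNIV) (closed_simplex \<sigma>)) (U \<inter> closed_simplex \<sigma>))"

definition geometric_realization :: "'a set set \<Rightarrow> ('a \<Rightarrow> real) topology" where
  "geometric_realization K = topology (weakly_open K)"

lemma istopology_weakly_open: "istopology (weakly_open K)"
  unfolding istopology_def
proof (intro conjI allI impI)
  fix S T :: "('a \<Rightarrow> real) set"
  assume S: "weakly_open K S" and T: "weakly_open K T"
  have "openin (subtopology (powertop_real UNIV) (closed_simplex \<sigma>)) (S \<inter> T \<inter> closed_simplex \<sigma>)"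
    if "\<sigma> \<in> K" for \<sigma>
  proof -
    have "S \<inter> T \<inter> closed_simplex \<sigma> = (S \<inter> closed_simplex \<sigma>) \<inter> (T \<inter> closed_simplex \<sigma>)"
      by blast
    with S T that show ?thesis
      by (metis openin_Int weakly_open_def)
  qed
  with S show "weakly_open K (S \<inter> T)"
    unfolding weakly_open_def by blast
next
  fix \<U> :: "('a \<Rightarrow> real) set set"
  assume \<U>: "\<forall>U\<in>\<U>. weakly_open K U"
  have "openin (subtopology (powertop_real UNIV) (closed_simplex \<sigma>)) (\<Union>\<U> \<inter> closed_simplex \<sigma>)"
    if "\<sigma> \<in> K" for \<sigma>
  proof -
    have "\<Union>\<U> \<inter> closed_simplex \<sigma> = (\<Union>U\<in>\<U>. U \<inter> closed_simplex \<sigma>)"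
      by blast
    moreover have "openin (subtopology (powertop_real UNIV) (closed_simplex \<sigma>))
        (\<Union>U\<in>\<U>. U \<inter> closed_simplex \<sigma>)"
      using \<U> that unfolding weakly_open_def by (intro openin_Union) blast
    ultimately show ?thesis by simp
  qed
  with \<U> show "weakly_open K (\<Union>\<U>)"
    unfolding weakly_open_def by blast
qed

lemma openin_geometric_realization: "openin (geometric_realization K) U \<longleftrightarrow> weakly_open K U"
  by (simp add: geometric_realization_def istopology_weakly_open topology_inverse')

lemma topspace_geometric_realization: "topspace (geometric_realization K) = realization_carrier K"
proof
  show "topspace (geometric_realization K) \<subseteq> realization_carrier K"
    using openin_topspace[of "geometric_realization K"]
    unfolding openin_geometric_realization weakly_open_def by blast
  have "weakly_open K (realization_carrier K)"
    unfolding weakly_open_def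
  proof (intro conjI ballI)
    fix \<sigma> assume "\<sigma> \<in> K"
    then have "realization_carrier K \<inter> closed_simplex \<sigma> = closed_simplex \<sigma>"
      unfolding realization_carrier_def by blast
    then show "openin (subtopology (powertop_real UNIV) (closed_simplex \<sigma>))
        (realization_carrier K \<inter> closed_simplex \<sigma>)"
      by (simp add: openin_subtopology_refl)
  qed simp
  then show "realization_carrier K \<subseteq> topspace (geometric_realization K)"
    by (simp add: openin_geometric_realization openin_subset)
qed

text \<open>
  For finite \<open>\<sigma>\<close>, the pairwise bound below says that the diameter is at most \<open>r\<close>.
\<close>

definition vietoris_rips :: "'a set \<Rightarrow> ('a \<Rightarrow> 'a \<Rightarrow> real) \<Rightarrow> real \<Rightarrow> 'a set set" where
  "vietoris_rips X d r =
     {\<sigma>. finite \<sigma> \<and> \<sigma> \<noteq> {} \<and> \<sigma> \<subseteq> X \<and> (\<forall>x\<in>\<sigma>. \<forall>y\<in>\<sigma>. d x y \<le> r)}"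

text \<open>
  The sphere of dimension \<open>m\<close> is the library's \<^const>\<open>nsphere\<close>: sequences
  \<open>x :: nat \<Rightarrow> real\<close> that vanish beyond index \<open>m\<close> and satisfy \<open>(\<Sum>i\<le>m. (x i)\<^sup>2) = 1\<close>.
  For \<open>m = 0\<close> the distance below is \<open>0\<close> or \<open>arccos (-1) = pi\<close>.
\<close>

definition sphere_dist :: "nat \<Rightarrow> (nat \<Rightarrow> real) \<Rightarrow> (nat \<Rightarrow> real) \<Rightarrow> real" where
  "sphere_dist m x y = arccos (\<Sum>i\<le>m. x i * y i)"

definition antipode :: "(nat \<Rightarrow> real) \<Rightarrow> (nat \<Rightarrow> real)" where
  "antipode x = (\<lambda>i. - x i)"

definition VR_sphere :: "nat \<Rightarrow> real \<Rightarrow> ((nat \<Rightarrow> real) \<Rightarrow> real) topology" where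
  "VR_sphere m r =
     geometric_realization (vietoris_rips (topspace (nsphere m)) (sphere_dist m) r)"

text \<open>
  The simplicial map induced by the antipodal map sends \<open>\<Sum>v. t v \<cdot> v\<close> to
  \<open>\<Sum>v. t v \<cdot> antipode v\<close>. As the antipodal map is an involution, the coordinate of the image
  at \<open>v\<close> is \<open>t (antipode v)\<close>.
\<close>

definition VR_antipode :: "((nat \<Rightarrow> real) \<Rightarrow> real) \<Rightarrow> ((nat \<Rightarrow> real) \<Rightarrow> real)" where
  "VR_antipode t = (\<lambda>v. t (antipode v))"

text \<open>
  A \<open>C\<^sub>2\<close>-space is a topology \<open>X\<close> together with the action \<open>\<tau>\<close> of the nontrivial group element.
\<close>

definition odd_map :: "nat \<Rightarrow> 'a topology \<Rightarrow> ('a \<Rightarrow> 'a) \<Rightarrow> ((nat \<Rightarrow> real) \<Rightarrow> 'a) \<Rightarrow> bool" where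
  "odd_map k X \<tau> f \<longleftrightarrow> continuous_map (nsphere k) X f \<and>
     (\<forall>x\<in>topspace (nsphere k). f (antipode x) = \<tau> (f x))"

definition coind :: "'a topology \<Rightarrow> ('a \<Rightarrow> 'a) \<Rightarrow> enat" where
  "coind X \<tau> = Sup {enat k | k. \<exists>f. odd_map k X \<tau> f}"

definition coind_threshold :: "nat \<Rightarrow> nat \<Rightarrow> real" where
  "coind_threshold m n = Inf {r. 0 \<le> r \<and> enat n \<le> coind (VR_sphere m r) VR_antipode}"

definition B :: "real \<Rightarrow> nat \<Rightarrow> nat" where
  "B r k = Max {l. k \<le> l \<and> coind_threshold (k - 1) (l - 1) \<le> r}"

definition Lambda :: "real \<Rightarrow> ereal" where
  "Lambda r = lim (\<lambda>k. ereal (real (B r k) / real k))"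

end

theory Submission
  imports Defs "HOL-Homology.Homology"
begin

text \<open>
  The value of \<^term>\<open>B r k\<close> depends on which odd maps into Vietoris--Rips complexes of
  spheres exist. There are two constructions of such maps and one obstruction, the Borsuk--Ulam
  theorem.

  \<^bold>\<open>Obstruction.\<close> Let \<open>\<phi>\<close> be an odd function from the sphere to \<open>(N+1)\<close>-space, continuous or
  not, such that the linear extension of \<open>\<phi>\<close> has no zero on any simplex of the complex. The weak
  topology makes this extension continuous, so after normalization it is an odd map from the
  complex to the \<open>N\<close>-sphere, and Borsuk--Ulam bounds the coindex by \<open>N\<close> (\<open>coind_VR_le\<close>). Two
  choices of \<open>\<phi>\<close> are used. The identity works as long as \<open>cos r > - 1 / (m+1)\<close>, because then no
  simplex has the origin as a barycentre (\<open>barycenter_nonzero\<close>); this range reaches strictly beyond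
  \<open>pi / 2\<close>, so \<open>coind_threshold m n > pi / 2\<close> whenever \<open>m < n\<close>. For any \<open>r < pi\<close>, the signs with
  which a point lies in small caps around \<open>\<plusminus>p\<close>, with \<open>p\<close> ranging over a finite net, give a finite
  bound (\<open>coind_VR_bounded\<close>), so that the maximum defining \<open>B\<close> is taken over a finite set.

  \<^bold>\<open>Construction at small scale.\<close> An odd partition of unity subordinate to small caps maps the
  \<open>m\<close>-sphere into its own complex at every positive scale (\<open>coind_VR_ge_dim\<close>), hence
  \<open>coind_threshold m m \<le> 0\<close>. With the obstruction this gives \<open>B r k = k\<close> for \<open>r \<le> pi / 2\<close>.

  \<^bold>\<open>Construction beyond \<open>pi / 2\<close>.\<close> If \<open>n+1\<close> unit vectors have pairwise inner products of absolute
  value at most \<open>- cos r\<close>, then choosing a sign for each of them yields a simplex, and all these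
  simplices together form the image of a cross-polytope boundary, that is, of the \<open>n\<close>-sphere
  (\<open>coind_VR_ge_of_nearly_orthogonal\<close>). For fixed \<open>c = - cos r > 0\<close> the number of such vectors in
  \<open>k\<close>-space grows exponentially in \<open>k\<close> (\<open>exists_nearly_orthogonal_family\<close>), which beats every
  multiple \<open>M * k\<close>.

  The Borsuk--Ulam theorem follows from Borsuk's theorem that an odd self-map of a sphere has odd
  degree. By \<open>Borsuk_odd_mapping_degree_step\<close> the degree of an odd map that preserves the equator
  agrees modulo 2 with the degree of its restriction to the equator. An arbitrary odd map is
  reduced to this case by a homotopy: a Lipschitz approximation cannot map the equator, which has
  lower dimension, onto all directions, so that after a reflection the equator can be pushed off
  the poles (\<open>odd_map_homotopic_equator_preserving\<close>).
\<close>

section \<open>Inner products and spheres of sequences\<close>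

text \<open>
  The inner product of the space that contains the unit sphere \<^term>\<open>nsphere m\<close>. The dimension is
  an argument instead of a type because it varies in the inductions below.
\<close>
definition ip :: "nat \<Rightarrow> (nat \<Rightarrow> real) \<Rightarrow> (nat \<Rightarrow> real) \<Rightarrow> real" where
  "ip m x y = (\<Sum>i\<le>m. x i * y i)"

abbreviation sph :: "nat \<Rightarrow> (nat \<Rightarrow> real) set" where
  "sph m \<equiv> topspace (nsphere m)"

lemma sph_iff: "x \<in> sph m \<longleftrightarrow> ip m x x = 1 \<and> (\<forall>i>m. x i = 0)"
  by (auto simp: nsphere ip_def power2_eq_square)

lemma nsphere_top_of_set: "nsphere m = top_of_set (sph m)"
proof -
  have eq: "nsphere m = top_of_set {x. (\<Sum>i\<le>m. x i ^ 2) = 1 \<and> (\<forall>i>m. x i = 0)}"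
    by (simp add: nsphere euclidean_product_topology)
  show ?thesis
    by (simp only: eq topspace_euclidean_subtopology)
qed

lemma ip_commute: "ip m x y = ip m y x"
  by (simp add: ip_def mult.commute)

lemma ip_add_left: "ip m (\<lambda>i. x i + y i) z = ip m x z + ip m y z"
  by (simp add: ip_def algebra_simps sum.distrib)

lemma ip_diff_left: "ip m (\<lambda>i. x i - y i) z = ip m x z - ip m y z"
  by (simp add: ip_def algebra_simps sum_subtractf)

lemma ip_scale_left: "ip m (\<lambda>i. c * x i) z = c * ip m x z"
  by (simp add: ip_def algebra_simps sum_distrib_left)

lemma ip_uminus_left: "ip m (\<lambda>i. - x i) z = - ip m x z"
  by (simp add: ip_def sum_negf)

lemma ip_add_right: "ip m z (\<lambda>i. x i + y i) = ip m z x + ip m z y"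
  by (simp add: ip_def algebra_simps sum.distrib)

lemma ip_diff_right: "ip m z (\<lambda>i. x i - y i) = ip m z x - ip m z y"
  by (simp add: ip_def algebra_simps sum_subtractf)

lemma ip_scale_right: "ip m z (\<lambda>i. c * x i) = c * ip m z x"
  by (simp add: ip_def algebra_simps sum_distrib_left)

lemma ip_uminus_right: "ip m z (\<lambda>i. - x i) = - ip m z x"
  by (simp add: ip_def sum_negf)

lemma ip_sum_left: "ip m (\<lambda>i. \<Sum>v\<in>P. w v * x v i) z = (\<Sum>v\<in>P. w v * ip m (x v) z)"
  unfolding ip_def sum_distrib_left sum_distrib_right
  by (subst sum.swap) (simp add: mult.assoc)

lemmas ip_linear = ip_add_left ip_diff_left ip_scale_left ip_uminus_left
  ip_add_right ip_diff_right ip_scale_right ip_uminus_right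

lemma ip_self_ge_0: "0 \<le> ip m x x"
  by (simp add: ip_def sum_nonneg)

lemma ip_self_eq_0_iff: "ip m x x = 0 \<longleftrightarrow> (\<forall>i\<le>m. x i = 0)"
  by (auto simp: ip_def sum_nonneg_eq_0_iff)

lemma ip_le_1:
  assumes "x \<in> sph m" "y \<in> sph m" shows "ip m x y \<le> 1"
  using assms ip_self_ge_0[of m "\<lambda>i. x i - y i"] ip_commute[of m y x]
  by (simp add: ip_linear sph_iff)

lemma ip_ge_minus_1:
  assumes "x \<in> sph m" "y \<in> sph m" shows "-1 \<le> ip m x y"
  using assms ip_self_ge_0[of m "\<lambda>i. x i + y i"] ip_commute[of m y x]
  by (simp add: ip_linear sph_iff)

lemma ip_eq_1D:
  assumes "x \<in> sph m" "y \<in> sph m" "ip m x y = 1" shows "x = y"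
proof -
  have "ip m (\<lambda>i. x i - y i) (\<lambda>i. x i - y i) = 0"
    using assms ip_commute[of m y x] by (simp add: ip_linear sph_iff)
  then have "\<forall>i\<le>m. x i - y i = 0" by (simp add: ip_self_eq_0_iff)
  then show ?thesis using assms
    by (intro ext) (metis eq_iff_diff_eq_0 linorder_not_le sph_iff)
qed

lemma abs_coord_le_1: "x \<in> sph m \<Longrightarrow> \<bar>x i\<bar> \<le> 1"
  by (metis abs_le_square_iff abs_1 one_power2 topspace_nsphere_1)

text \<open>
  Two points of a small cap are close to each other: this is the estimate
  \<open>\<bar>p - q\<bar>\<^sup>2 \<le> 2 * \<bar>p - x\<bar>\<^sup>2 + 2 * \<bar>x - q\<bar>\<^sup>2\<close> written with inner products.
\<close>
lemma caps_meet_ip: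
  assumes "x \<in> sph m" "p \<in> sph m" "q \<in> sph m" "ip m x p > s" "ip m x q > s"
  shows "ip m p q > 1 - 4 * (1 - s)"
proof -
  have "0 \<le> ip m (\<lambda>i. 2 * x i - (p i + q i)) (\<lambda>i. 2 * x i - (p i + q i))"
    by (rule ip_self_ge_0)
  also have "\<dots> = 6 + 2 * ip m p q - 4 * ip m x p - 4 * ip m x q"
    using assms ip_commute[of m p x] ip_commute[of m q x] ip_commute[of m q p]
    by (simp add: ip_linear sph_iff)
  finally show ?thesis using assms by simp
qed

lemma antipode_in_sph [simp]: "antipode x \<in> sph m \<longleftrightarrow> x \<in> sph m"
  by (simp add: sph_iff antipode_def ip_linear)

lemma antipode_antipode [simp]: "antipode (antipode x) = x"
  by (simp add: antipode_def)

lemma antipode_apply: "antipode x i = - x i"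
  by (simp add: antipode_def)

lemma ip_antipode [simp]:
  "ip m (antipode x) y = - ip m x y" "ip m x (antipode y) = - ip m x y"
  by (simp_all add: antipode_def ip_linear)

lemma continuous_map_ip [continuous_intros]:
  assumes "\<And>i. continuous_map X euclideanreal (\<lambda>x. f x i)"
    and "\<And>i. continuous_map X euclideanreal (\<lambda>x. g x i)"
  shows "continuous_map X euclideanreal (\<lambda>x. ip m (f x) (g x))"
  unfolding ip_def by (intro continuous_intros assms) auto

lemma continuous_map_coordinate:
  assumes "continuous_map X (nsphere m) f"
  shows "continuous_map X euclideanreal (\<lambda>x. f x i)"
  using continuous_map_compose[OF assms continuous_map_nsphere_projection[of m i]]
  by (simp add: o_def)

lemma continuous_on_ip [continuous_intros]:
  assumes "\<And>i. continuous_on S (\<lambda>x. f x i)" "\<And>i. continuous_on S (\<lambda>x. g x i)"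
  shows "continuous_on S (\<lambda>x. ip m (f x) (g x))"
  unfolding ip_def by (intro continuous_intros assms)

lemma continuous_map_into_sphere:
  assumes "\<And>i. continuous_map X euclideanreal (\<lambda>x. f x i)"
    and "\<And>x. x \<in> topspace X \<Longrightarrow> f x \<in> sph m"
  shows "continuous_map X (nsphere m) f"
  unfolding nsphere using assms
  by (auto simp: continuous_map_in_subtopology continuous_map_componentwise_UNIV nsphere)

section \<open>Normalization and homotopies of sphere maps\<close>

definition unit_vec :: "nat \<Rightarrow> (nat \<Rightarrow> real) \<Rightarrow> nat \<Rightarrow> real" where
  "unit_vec m u = (\<lambda>i. if i \<le> m then u i / sqrt (ip m u u) else 0)"

lemma ip_cong: "(\<And>i. i \<le> m \<Longrightarrow> x i = x' i) \<Longrightarrow> (\<And>i. i \<le> m \<Longrightarrow> y i = y' i) \<Longrightarrow> ip m x y = ip m x' y'"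
  by (simp add: ip_def)

lemma unit_vec_in_sph: 
  assumes "ip m u u \<noteq> 0" shows "unit_vec m u \<in> sph m"
proof -
  have "ip m (unit_vec m u) (unit_vec m u) = ip m (\<lambda>i. 1 / sqrt (ip m u u) * u i) (\<lambda>i. 1 / sqrt (ip m u u) * u i)"
    by (intro ip_cong) (auto simp: unit_vec_def)
  also have "\<dots> = 1"
    using assms ip_self_ge_0[of m u] by (simp only: ip_linear) simp
  finally show ?thesis by (simp add: sph_iff unit_vec_def)
qed

lemma unit_vec_id: "x \<in> sph m \<Longrightarrow> unit_vec m x = x"
  by (auto simp: unit_vec_def sph_iff)

lemma unit_vec_uminus: "unit_vec m (\<lambda>i. - u i) = antipode (unit_vec m u)"
  by (auto simp: unit_vec_def antipode_def ip_linear)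

lemma continuous_map_unit_vec:
  assumes "\<And>i. continuous_map X euclideanreal (\<lambda>x. f x i)"
    and "\<And>x. x \<in> topspace X \<Longrightarrow> ip m (f x) (f x) \<noteq> 0"
  shows "continuous_map X (nsphere m) (\<lambda>x. unit_vec m (f x))"
proof (rule continuous_map_into_sphere)
  fix i
  show "continuous_map X euclideanreal (\<lambda>x. unit_vec m (f x) i)"
    unfolding unit_vec_def using assms
    by (cases "i \<le> m") (auto intro!: continuous_intros)
qed (use assms in \<open>simp add: unit_vec_in_sph\<close>)

text \<open>
  The straight line from \<open>u\<close> to \<open>v\<close>, pushed radially to the sphere.
\<close>
lemma homotopic_unit_vec:
  assumes u: "\<And>i. continuous_map X euclideanreal (\<lambda>x. u x i)"
    and v: "\<And>i. continuous_map X euclideanreal (\<lambda>x. v x i)"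
    and nz: "\<And>x t. x \<in> topspace X \<Longrightarrow> 0 \<le> t \<Longrightarrow> t \<le> 1 \<Longrightarrow> \<exists>i\<le>m. (1 - t) * u x i + t * v x i \<noteq> 0"
  shows "homotopic_with (\<lambda>x. True) X (nsphere m) (\<lambda>x. unit_vec m (u x)) (\<lambda>x. unit_vec m (v x))"
proof -
  define h where "h = (\<lambda>z::real\<times>_. unit_vec m (\<lambda>i. (1 - fst z) * u (snd z) i + fst z * v (snd z) i))"
  have "continuous_map (prod_topology (top_of_set {0..1}) X) (nsphere m) h"
    unfolding h_def
  proof (rule continuous_map_unit_vec)
    fix i
    have 1: "continuous_map (prod_topology (top_of_set {0..1}) X) euclideanreal fst"
      using continuous_map_compose[OF continuous_map_fst continuous_map_from_subtopology[OF continuous_map_id]]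
      by (metis comp_id continuous_map_fst continuous_map_into_fulltopology)
    have 2: "continuous_map (prod_topology (top_of_set {0..1::real}) X) euclideanreal (\<lambda>z. g (snd z))"
      if "continuous_map X euclideanreal g" for g
      using continuous_map_compose[OF continuous_map_snd that] by (simp add: o_def)
    show "continuous_map (prod_topology (top_of_set {0..1}) X) euclideanreal
         (\<lambda>x. (1 - fst x) * u (snd x) i + fst x * v (snd x) i)"
      by (intro continuous_intros 1 2 u v)
  qed (use nz in \<open>auto simp: ip_self_eq_0_iff\<close>)
  then show ?thesis
    unfolding homotopic_with_def
    by (intro exI[of _ h]) (auto simp: h_def)
qed

section \<open>Compactness and symmetric nets\<close>

lemma compact_sph: "compact (sph m)"
proof -
  have "compact (PiE UNIV (\<lambda>_::nat. {-1..1::real}))"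
    using compactin_PiE[of "\<lambda>_::nat. euclideanreal" UNIV "\<lambda>_. {-1..1}"]
    by (simp add: euclidean_product_topology)
  moreover have "closed (sph m)"
  proof -
    have "sph m = {x. ip m x x = 1} \<inter> (\<Inter>i\<in>{m<..}. {x. x i = 0})"
      by (auto simp: sph_iff)
    moreover have "closed \<dots>"
      by (intro closed_Int closed_INT ballI closed_Collect_eq continuous_intros
          continuous_on_product_coordinates)
    ultimately show ?thesis by simp
  qed
  moreover have "sph m \<subseteq> PiE UNIV (\<lambda>_::nat. {-1..1::real})"
    using abs_coord_le_1 by (fastforce simp: abs_le_iff)
  ultimately show ?thesis
    by (metis compact_Int_closed inf.absorb_iff2)
qed

lemma symmetric_net:
  assumes "s < 1"
  obtains P where "finite P" "P \<subseteq> sph m" "antipode ` P = P"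
    "\<And>x. x \<in> sph m \<Longrightarrow> \<exists>p\<in>P. ip m x p > s"
proof -
  have op: "open {x. ip m x p > s}" for p
    by (intro open_Collect_less continuous_intros continuous_on_product_coordinates)
  have cov: "sph m \<subseteq> (\<Union>p\<in>sph m. {x. ip m x p > s})"
    using assms by (auto simp: sph_iff)
  obtain Q where Q: "Q \<subseteq> sph m" "finite Q" "sph m \<subseteq> (\<Union>p\<in>Q. {x. ip m x p > s})"
    using compactE_image[OF compact_sph, of "sph m" "\<lambda>p. {x. ip m x p > s}"] op cov by metis
  show ?thesis
  proof (rule that[of "Q \<union> antipode ` Q"])
    show "antipode ` (Q \<union> antipode ` Q) = Q \<union> antipode ` Q"
      by (auto simp: image_Un image_image)
  qed (use Q in auto)
qed

lemma continuous_map_nsphere_iff: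
  "continuous_map (nsphere n) (nsphere m) f \<longleftrightarrow> continuous_on (sph n) f \<and> f \<in> sph n \<rightarrow> sph m"
proof -
  have "continuous_map (nsphere n) (nsphere m) f = continuous_map (top_of_set (sph n)) (top_of_set (sph m)) f"
    using nsphere_top_of_set by metis
  then show ?thesis by (simp only: continuous_map_iff_continuous2 image_subset_iff_funcset) auto
qed

section \<open>Lipschitz maps into a space of higher dimension\<close>

text \<open>
  A counting form of the fact that Lipschitz maps do not raise dimension. The cube of dimension
  \<open>k+1\<close> contains \<open>(N+1)^(k+1)\<close> grid points at mutual distance at least \<open>1 / N\<close>. Preimages of
  different grid points have distance of order \<open>1 / N\<close> as well, so at most of order \<open>N^k\<close> of them
  fit into a bounded part of \<open>k\<close>-space.
\<close>
lemma lipschitz_image_misses_point_of_cube: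
  fixes q :: "(nat \<Rightarrow> real) \<Rightarrow> nat \<Rightarrow> real" and L R :: nat
  assumes lip: "\<And>y z i. i \<le> k \<Longrightarrow> \<forall>j\<ge>k. y j = 0 \<Longrightarrow> \<forall>j\<ge>k. z j = 0 \<Longrightarrow>
      \<bar>q y i - q z i\<bar> \<le> real L * (\<Sum>j<k. \<bar>y j - z j\<bar>)"
  obtains a where "\<And>i. i \<le> k \<Longrightarrow> 0 \<le> a i \<and> a i \<le> 1"
    "\<And>y. \<lbrakk>\<forall>j\<ge>k. y j = 0; \<forall>j. \<bar>y j\<bar> \<le> real R\<rbrakk> \<Longrightarrow> \<exists>i\<le>k. q y i \<noteq> a i"
proof (rule ccontr)
  note miss = that
  assume contra: "\<not> thesis"
  have "\<exists>y. (\<forall>j\<ge>k. y j = 0) \<and> (\<forall>j. \<bar>y j\<bar> \<le> real R) \<and> (\<forall>i\<le>k. q y i = a i)"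
    if a: "\<And>i. i \<le> k \<Longrightarrow> 0 \<le> a i \<and> a i \<le> 1" for a :: "nat \<Rightarrow> real"
  proof (rule ccontr)
    assume none: "\<not> ?thesis"
    have thesis by (rule miss[of a]) (use a none in auto)
    with contra show False by contradiction
  qed
  then obtain Y where Y: "\<And>a::nat\<Rightarrow>real. (\<And>i. i \<le> k \<Longrightarrow> 0 \<le> a i \<and> a i \<le> 1) \<Longrightarrow>
      (\<forall>j\<ge>k. Y a j = 0) \<and> (\<forall>j. \<bar>Y a j\<bar> \<le> real R) \<and> (\<forall>i\<le>k. q (Y a) i = a i)"
    by metis
  \<comment> \<open>Cells of side \<open>1 / (N * C)\<close> are so small that two preimages in one cell have images at distance
    less than \<open>1 / N\<close>. The number of cells is at most \<open>(D * N) ^ k\<close>, and \<open>N = D ^ k\<close> makes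
    this equal to \<open>N ^ (k + 1)\<close>, which is less than the number of grid points.\<close>
  define C where "C = Suc (L * k)"
  define D where "D = 2 * R * C + 1"
  define N where "N = D ^ k"
  define M where "M = N * C"
  have D0: "D > 0" and C0: "C > 0" and N0: "N > 0" and M0: "M > 0"
    by (simp_all add: D_def C_def N_def M_def)
  define y where "y = (\<lambda>g::nat\<Rightarrow>nat. Y (\<lambda>i. real (g i) / real N))"
  define cell where "cell = (\<lambda>g. \<lambda>j\<in>{..<k}. nat \<lfloor>(y g j + real R) * real M\<rfloor>)"
  let ?G = "PiE {..k} (\<lambda>_. {..N})"
  have y: "\<forall>j\<ge>k. y g j = 0" "\<forall>j. \<bar>y g j\<bar> \<le> real R" "\<forall>i\<le>k. q (y g) i = real (g i) / real N"
    if "g \<in> ?G" for g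
  proof -
    have "real (g i) / real N \<le> 1" if "i \<le> k" for i
      using \<open>g \<in> ?G\<close> that N0 by (auto simp: PiE_iff)
    then show "\<forall>j\<ge>k. y g j = 0" "\<forall>j. \<bar>y g j\<bar> \<le> real R" "\<forall>i\<le>k. q (y g) i = real (g i) / real N"
      using Y[of "\<lambda>i. real (g i) / real N"] unfolding y_def by simp_all
  qed
  have "cell ` ?G \<subseteq> PiE {..<k} (\<lambda>_. {..2 * R * M})"
  proof (rule image_subsetI)
    fix g assume g: "g \<in> ?G"
    have "nat \<lfloor>(y g j + real R) * real M\<rfloor> \<le> 2 * R * M" for j
    proof -
      have "(y g j + real R) * real M \<le> (2 * real R) * real M"
        using y(2)[OF g] by (intro mult_right_mono) (smt (verit, best), simp)
      also have "\<dots> = real (2 * R * M)" by simp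
      finally show ?thesis by linarith
    qed
    then show "cell g \<in> PiE {..<k} (\<lambda>_. {..2 * R * M})"
      unfolding cell_def by auto
  qed
  moreover have "inj_on cell ?G"
  proof (rule inj_onI)
    fix g h assume g: "g \<in> ?G" and h: "h \<in> ?G" and eq: "cell g = cell h"
    have close: "\<bar>y g j - y h j\<bar> \<le> 1 / real M" if "j < k" for j
    proof -
      have "0 \<le> (y f j + real R) * real M" if "f \<in> ?G" for f
      proof -
        have "\<bar>y f j\<bar> \<le> real R" using y(2)[OF that] by blast
        then have "0 \<le> y f j + real R" by linarith
        then show ?thesis by simp
      qed
      moreover have "nat \<lfloor>(y g j + real R) * real M\<rfloor> = nat \<lfloor>(y h j + real R) * real M\<rfloor>"
        using fun_cong[OF eq, of j] that by (simp add: cell_def)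
      ultimately have "\<lfloor>(y g j + real R) * real M\<rfloor> = \<lfloor>(y h j + real R) * real M\<rfloor>"
        using g h by (metis eq_nat_nat_iff zero_le_floor)
      then have "\<bar>(y g j + real R) * real M - (y h j + real R) * real M\<bar> \<le> 1"
        by linarith
      moreover have "(y g j + real R) * real M - (y h j + real R) * real M = (y g j - y h j) * real M"
        by (simp add: algebra_simps)
      ultimately have "\<bar>y g j - y h j\<bar> * real M \<le> 1"
        by (simp add: abs_mult)
      then show ?thesis using M0 by (simp add: field_simps)
    qed
    have "g i = h i" if "i \<le> k" for i
    proof -
      have "\<bar>real (g i) / real N - real (h i) / real N\<bar> = \<bar>q (y g) i - q (y h) i\<bar>"
        using y(3) g h that by simp
      also have "\<dots> \<le> real L * (\<Sum>j<k. \<bar>y g j - y h j\<bar>)"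
        using y(1) g h that by (intro lip) auto
      also have "\<dots> \<le> real L * (\<Sum>j<k. 1 / real M)"
        using close by (intro mult_left_mono sum_mono) auto
      also have "\<dots> = real (L * k) / real C / real N"
        by (simp add: M_def)
      also have "\<dots> < 1 / real N"
      proof (rule divide_strict_right_mono)
        have "real (L * k) < 1 * real C" unfolding C_def by simp
        then show "real (L * k) / real C < 1"
          using C0 by (subst pos_divide_less_eq) auto
      qed (use N0 in simp)
      finally have "\<bar>real (g i) - real (h i)\<bar> < 1"
        using N0 by (simp add: abs_divide field_simps flip: diff_divide_distrib)
      then show ?thesis by linarith
    qed
    then show "g = h"
      using g h by (intro PiE_ext[of g "{..k}"]) auto
  qed
  ultimately have "card ?G \<le> card (PiE {..<k} (\<lambda>_. {..2 * R * M}))"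
    by (intro card_inj_on_le) (auto intro: finite_PiE)
  then have "(N + 1) ^ (k + 1) \<le> (2 * R * M + 1) ^ k"
    by (simp add: card_PiE)
  also have "2 * R * M + 1 \<le> D * N"
    using N0 by (simp add: M_def D_def algebra_simps)
  then have "(2 * R * M + 1) ^ k \<le> (D * N) ^ k"
    by (intro power_mono) auto
  also have "\<dots> = N ^ (k + 1)"
    by (simp add: N_def power_mult_distrib)
  also have "\<dots> < (N + 1) ^ (k + 1)"
    by (intro power_strict_mono) auto
  finally show False by simp
qed

lemma L2_set_ip: "L2_set y {..n} = sqrt (ip n y y)"
  by (simp add: L2_set_def ip_def power2_eq_square)

text \<open>
  A homogeneous map turns a missed point into a missed direction. The lower bound \<open>\<kappa>\<close> is what
  keeps all candidate preimages of the unit cube inside one bounded cube.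
\<close>
lemma homogeneous_lipschitz_misses_direction:
  fixes q :: "(nat \<Rightarrow> real) \<Rightarrow> nat \<Rightarrow> real"
  assumes lip: "\<And>y z i. \<bar>q y i - q z i\<bar> \<le> L * (\<Sum>j\<le>n. \<bar>y j - z j\<bar>)"
    and hom: "\<And>c y i. c \<ge> 0 \<Longrightarrow> q (\<lambda>j. c * y j) i = c * q y i"
    and odd: "\<And>y i. q (\<lambda>j. - y j) i = - q y i"
    and pos: "\<kappa> > 0" "\<And>x. x \<in> sph n \<Longrightarrow> ip n (q x) (q x) \<ge> \<kappa>"
  obtains a where "a \<in> sph n" "\<And>x c. \<lbrakk>x \<in> sph n; x n = 0\<rbrakk> \<Longrightarrow> \<exists>i\<le>n. q x i \<noteq> c * a i"
proof -
  obtain R :: nat where R: "real (n + 1) / \<kappa> \<le> real R"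
    using real_arch_simple by blast
  obtain L' :: nat where L': "L \<le> real L'"
    using real_arch_simple by blast
  have lip': "\<bar>q y i - q z i\<bar> \<le> real L' * (\<Sum>j<n. \<bar>y j - z j\<bar>)"
    if "\<forall>j\<ge>n. y j = 0" "\<forall>j\<ge>n. z j = 0" for y z i
  proof -
    have "(\<Sum>j\<le>n. \<bar>y j - z j\<bar>) = (\<Sum>j<n. \<bar>y j - z j\<bar>)"
      using that by (simp flip: lessThan_Suc_atMost)
    then have "\<bar>q y i - q z i\<bar> \<le> L * (\<Sum>j<n. \<bar>y j - z j\<bar>)"
      using lip[of y i z] by simp
    also have "\<dots> \<le> real L' * (\<Sum>j<n. \<bar>y j - z j\<bar>)"
      using L' by (intro mult_right_mono sum_nonneg) auto
    finally show ?thesis .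
  qed
  obtain b where b: "\<And>i. i \<le> n \<Longrightarrow> 0 \<le> b i \<and> b i \<le> 1"
    and miss: "\<And>y. \<lbrakk>\<forall>j\<ge>n. y j = 0; \<forall>j. \<bar>y j\<bar> \<le> real (R + 1)\<rbrakk> \<Longrightarrow> \<exists>i\<le>n. q y i \<noteq> b i"
    by (rule lipschitz_image_misses_point_of_cube[of n q L' "R + 1"]) (use lip' in blast)+
  have q0: "q (\<lambda>_. 0) i = 0" for i
    using hom[of 0 "\<lambda>_. 0" i] by simp
  have bnz: "ip n b b \<noteq> 0"
    using miss[of "\<lambda>_. 0"] q0 by (fastforce simp: ip_self_eq_0_iff)
  have ble: "ip n b b \<le> real (n + 1)"
  proof -
    have "ip n b b \<le> (\<Sum>i\<le>n. 1)"
      unfolding ip_def using b by (intro sum_mono) (simp add: mult_le_one)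
    then show ?thesis by simp
  qed
  have no: False if x: "x \<in> sph n" "x n = 0" and eq: "\<And>i. i \<le> n \<Longrightarrow> c * q x i = b i" for x c
  proof -
    define y where "y = (\<lambda>j. c * x j)"
    have qy: "q y i = c * q x i" for i
    proof (cases "c \<ge> 0")
      case True
      then show ?thesis using hom by (simp add: y_def)
    next
      case False
      have "y = (\<lambda>j. - ((-c) * x j))" by (simp add: y_def)
      then have "q y i = - q (\<lambda>j. (-c) * x j) i" using odd by metis
      also have "\<dots> = c * q x i" using hom[of "-c" x i] False by simp
      finally show ?thesis .
    qed
    have "c\<^sup>2 * \<kappa> \<le> c\<^sup>2 * ip n (q x) (q x)"
      using pos x by (intro mult_left_mono) auto
    also have "\<dots> = ip n (\<lambda>i. c * q x i) (\<lambda>i. c * q x i)"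
      by (simp add: ip_linear power2_eq_square)
    also have "\<dots> = ip n b b"
      using eq by (intro ip_cong) auto
    also have "\<dots> \<le> real (n + 1)" by (rule ble)
    finally have "c\<^sup>2 \<le> real (n + 1) / \<kappa>"
      using pos by (simp add: field_simps)
    also have "\<dots> \<le> real R" by (rule R)
    also have "\<dots> \<le> (real (R + 1))\<^sup>2"
      by (simp add: power2_eq_square algebra_simps)
    finally have "\<bar>c\<bar> \<le> real (R + 1)"
      using abs_le_square_iff[of c "real (R+1)"] by simp
    then have "\<bar>y j\<bar> \<le> real (R + 1)" for j
      using mult_mono[of "\<bar>c\<bar>" "real (R+1)" "\<bar>x j\<bar>" 1] abs_coord_le_1[OF x(1), of j]
      by (simp add: y_def abs_mult)
    moreover have "\<forall>j\<ge>n. y j = 0"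
      using x by (auto simp: y_def sph_iff le_less)
    ultimately show False
      using miss[of y] qy eq by auto
  qed
  show ?thesis
  proof (rule that)
    show "unit_vec n b \<in> sph n" using bnz by (rule unit_vec_in_sph)
    fix x c assume x: "x \<in> sph n" "x n = 0"
    show "\<exists>i\<le>n. q x i \<noteq> c * unit_vec n b i"
    proof (rule ccontr)
      assume "\<not> ?thesis"
      then have eq: "q x i = c / sqrt (ip n b b) * b i" if "i \<le> n" for i
        using that by (auto simp: unit_vec_def)
      have "c \<noteq> 0"
      proof
        assume "c = 0"
        then have "ip n (q x) (q x) = 0" using eq by (auto simp: ip_self_eq_0_iff)
        with pos x show False by fastforce
      qed
      then have "sqrt (ip n b b) / c * q x i = b i" if "i \<le> n" for i
        using eq[OF that] bnz by simp
      then show False using no[OF x] by blast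
    qed
  qed
qed

section \<open>Reflections\<close>

text \<open>
  The reflection in the hyperplane orthogonal to \<open>w\<close>. For \<open>w = 0\<close> division by zero makes it the
  identity, so the two points exchanged in \<open>reflect_swaps_unit_vectors\<close> may coincide.
\<close>
definition reflect :: "nat \<Rightarrow> (nat \<Rightarrow> real) \<Rightarrow> (nat \<Rightarrow> real) \<Rightarrow> nat \<Rightarrow> real" where
  "reflect m w u = (\<lambda>i. u i - (2 * ip m u w / ip m w w) * w i)"

lemma ip_reflect: "ip m (reflect m w u) (reflect m w v) = ip m u v"
proof (cases "ip m w w = 0")
  case True
  then show ?thesis by (simp add: reflect_def)
next
  case False
  have "ip m (reflect m w u) (reflect m w v) = ip m u v
    - 2 * ip m v w / ip m w w * ip m u w - 2 * ip m u w / ip m w w * ip m w v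
    + 2 * ip m u w / ip m w w * (2 * ip m v w / ip m w w * ip m w w)"
    by (simp only: reflect_def ip_linear) (simp add: algebra_simps)
  also have "\<dots> = ip m u v"
    using False by (simp add: ip_commute[of m w v])
  finally show ?thesis .
qed

lemma reflect_swaps_unit_vectors:
  assumes "a \<in> sph m" "e \<in> sph m"
  shows "reflect m (\<lambda>i. a i - e i) e = a"
proof (cases "ip m e a = 1")
  case True
  then have "e = a" using assms ip_eq_1D by blast
  then show ?thesis by (simp add: reflect_def)
next
  case False
  have 1: "ip m (\<lambda>i. a i - e i) (\<lambda>i. a i - e i) = 2 * (1 - ip m e a)"
    using assms ip_commute[of m a e] by (simp add: ip_linear sph_iff)
  have 2: "ip m e (\<lambda>i. a i - e i) = - (1 - ip m e a)"
    using assms by (simp add: ip_linear sph_iff)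
  show ?thesis
    unfolding reflect_def 1 2 using False by (auto simp: field_simps)
qed

lemma reflect_reflect: "reflect m w (reflect m w u) = u"
proof (cases "ip m w w = 0")
  case False
  then have "ip m (reflect m w u) w = - ip m u w"
    by (simp only: reflect_def ip_linear) simp
  then show ?thesis by (simp add: reflect_def[of m w "reflect m w u"]) (simp add: reflect_def)
qed (simp add: reflect_def)

lemma reflect_scale: "reflect m w (\<lambda>i. c * u i) = (\<lambda>i. c * reflect m w u i)"
  by (auto simp: reflect_def ip_linear algebra_simps)

lemma reflect_cong: "(\<And>i. i \<le> m \<Longrightarrow> u i = v i) \<Longrightarrow> i \<le> m \<Longrightarrow> reflect m w u i = reflect m w v i"
  using ip_cong[of m u v w w] by (simp add: reflect_def)

lemma continuous_map_reflect:
  assumes "\<And>i. continuous_map X euclideanreal (\<lambda>x. f x i)"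
  shows "continuous_map X euclideanreal (\<lambda>x. reflect m w (f x) i)"
proof -
  have "continuous_map X euclideanreal (\<lambda>x. f x i - ip m (f x) (\<lambda>j. (2 / ip m w w * w i) * w j))"
    by (intro continuous_intros assms) auto
  moreover have "f x i - ip m (f x) (\<lambda>j. (2 / ip m w w * w i) * w j) = reflect m w (f x) i" for x
    by (simp only: reflect_def ip_linear) simp
  ultimately show ?thesis by simp
qed

section \<open>The Borsuk--Ulam theorem\<close>

text \<open>
  The approximation \<open>q\<close> sums the values of \<open>f\<close> at the points of a symmetric net, where the
  weight of \<open>f v\<close> vanishes at \<open>x\<close> unless \<open>v\<close> lies in a small cap around \<open>x\<close>. For such \<open>v\<close> the inner
  product of \<open>f v\<close> and \<open>f x\<close> is positive, so \<open>q x\<close> lies in the open half-space around \<open>f x\<close>.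
  The weights are written
  homogeneously, so that \<open>q\<close> is defined on the whole space and commutes with scaling.
\<close>
lemma odd_map_lipschitz_approximation:
  assumes f: "continuous_map (nsphere n) (nsphere n) f"
    and odd: "\<And>x. x \<in> sph n \<Longrightarrow> f (antipode x) = antipode (f x)"
  obtains q L \<kappa> where
    "\<And>y z i. \<bar>q y i - q z i\<bar> \<le> L * (\<Sum>j\<le>n. \<bar>y j - z j\<bar>)"
    "\<And>c y i. c \<ge> 0 \<Longrightarrow> q (\<lambda>j. c * y j) i = c * q y i"
    "\<And>y i. q (\<lambda>j. - y j) i = - q y i"
    "\<kappa> > 0" "\<And>x. x \<in> sph n \<Longrightarrow> ip n (q x) (q x) \<ge> \<kappa>"
    "\<And>x. x \<in> sph n \<Longrightarrow> ip n (q x) (f x) > 0"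
    "\<And>i. continuous_map (nsphere n) euclideanreal (\<lambda>x. q x i)"
proof -
  have cf: "continuous_on (sph n) f" and fS: "\<And>x. x \<in> sph n \<Longrightarrow> f x \<in> sph n"
    using f by (auto simp: continuous_map_nsphere_iff)
  have cfi: "continuous_on (sph n) (\<lambda>x. f x i)" for i
    by (rule continuous_on_product_then_coordinatewise[OF cf])
  \<comment> \<open>Uniform continuity of \<open>f\<close>: on the compact set of pairs whose images have nonpositive inner product,
    the inner product of the points themselves stays away from 1.\<close>
  obtain s where s: "s < 1" "\<And>x v. \<lbrakk>x \<in> sph n; v \<in> sph n; ip n x v > s\<rbrakk> \<Longrightarrow> ip n (f v) (f x) > 0"
  proof -
    define A where "A = {z \<in> sph n \<times> sph n. ip n (f (snd z)) (f (fst z)) \<le> 0}"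
    have c1: "continuous_on (sph n \<times> sph n) (\<lambda>z. f (fst z) i)"
         "continuous_on (sph n \<times> sph n) (\<lambda>z. f (snd z) i)" for i
      by (intro continuous_on_compose2[OF cfi] continuous_intros; force)+
    have coord: "continuous_on A (\<lambda>z. fst z i)" "continuous_on A (\<lambda>z. snd z i)" 
      for i and A :: "((nat\<Rightarrow>real)\<times>(nat\<Rightarrow>real)) set"
      by (rule continuous_on_product_then_coordinatewise, intro continuous_intros)+
    have "closedin (top_of_set (sph n \<times> sph n)) A"
      using continuous_closedin_preimage[of "sph n \<times> sph n" "\<lambda>z. ip n (f (snd z)) (f (fst z))" "{..0}"]
      by (simp add: A_def vimage_def Int_def conj_commute continuous_on_ip c1)
    then have "compact A"
      by (rule closedin_compact[OF compact_Times[OF compact_sph compact_sph]])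
    show ?thesis
    proof (cases "A = {}")
      case True
      show ?thesis
      proof (rule that[of 0])
        fix x v assume "x \<in> sph n" "v \<in> sph n"
        moreover have "(x, v) \<notin> A" using True by blast
        ultimately show "ip n (f v) (f x) > 0" by (simp add: A_def)
      qed simp
    next
      case False
      obtain z where z: "z \<in> A" "\<forall>y\<in>A. ip n (fst y) (snd y) \<le> ip n (fst z) (snd z)"
      proof -
        have "continuous_on A (\<lambda>z. ip n (fst z) (snd z))"
          by (intro continuous_on_ip coord)
        from continuous_attains_sup[OF \<open>compact A\<close> False this] show thesis
          using that by blast
      qed
      have zS: "fst z \<in> sph n" "snd z \<in> sph n" and zl: "ip n (f (snd z)) (f (fst z)) \<le> 0"
        using z(1) by (auto simp: A_def)
      have "ip n (fst z) (snd z) \<noteq> 1"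
      proof
        assume "ip n (fst z) (snd z) = 1"
        then have "fst z = snd z" using zS ip_eq_1D by blast
        with zl fS[OF zS(1)] show False by (simp add: sph_iff)
      qed
      then have "ip n (fst z) (snd z) < 1" using ip_le_1[OF zS] by simp
      then show ?thesis
      proof (rule that)
        fix x v assume "x \<in> sph n" "v \<in> sph n" "ip n (fst z) (snd z) < ip n x v"
        moreover from this have "(x, v) \<notin> A" using bspec[OF z(2), of "(x, v)"] by auto
        ultimately show "ip n (f v) (f x) > 0" by (simp add: A_def)
      qed
    qed
  qed
  obtain P where P: "finite P" "P \<subseteq> sph n" "antipode ` P = P"
    and net: "\<And>x. x \<in> sph n \<Longrightarrow> \<exists>p\<in>P. ip n x p > s"
    using symmetric_net[OF s(1), of n] by metis
  define w where "w = (\<lambda>v y. max 0 (ip n y v - s * sqrt (ip n y y)))"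
  define q where "q = (\<lambda>y i. \<Sum>v\<in>P. w v y * f v i)"
  have w_lip: "\<bar>w v y - w v z\<bar> \<le> (1 + \<bar>s\<bar>) * (\<Sum>j\<le>n. \<bar>y j - z j\<bar>)" if "v \<in> P" for v y z
  proof -
    have vS: "v \<in> sph n" using P that by blast
    have "\<bar>ip n y v - ip n z v\<bar> = \<bar>\<Sum>j\<le>n. (y j - z j) * v j\<bar>"
      by (simp add: ip_def algebra_simps sum_subtractf)
    also have "\<dots> \<le> (\<Sum>j\<le>n. \<bar>y j - z j\<bar>)"
      by (rule order_trans[OF sum_abs], intro sum_mono)
         (simp add: abs_mult mult_left_le abs_coord_le_1[OF vS])
    finally have 1: "\<bar>ip n y v - ip n z v\<bar> \<le> (\<Sum>j\<le>n. \<bar>y j - z j\<bar>)" .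
    have tri: "L2_set y {..n} - L2_set z {..n} \<le> (\<Sum>j\<le>n. \<bar>y j - z j\<bar>)" for y z :: "nat \<Rightarrow> real"
      using L2_set_triangle_ineq[of "\<lambda>j. y j - z j" z "{..n}"] L2_set_le_sum_abs[of "\<lambda>j. y j - z j" "{..n}"]
      by simp
    have "\<bar>sqrt (ip n y y) - sqrt (ip n z z)\<bar> \<le> (\<Sum>j\<le>n. \<bar>y j - z j\<bar>)"
      using tri[of y z] tri[of z y] by (simp add: abs_le_iff abs_minus_commute flip: L2_set_ip)
    then have "\<bar>s * sqrt (ip n y y) - s * sqrt (ip n z z)\<bar> \<le> \<bar>s\<bar> * (\<Sum>j\<le>n. \<bar>y j - z j\<bar>)"
      by (simp add: mult_left_mono abs_mult flip: right_diff_distrib)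
    with 1 show ?thesis
      unfolding w_def by (simp add: algebra_simps)
  qed
  have q_lip: "\<bar>q y i - q z i\<bar> \<le> (real (card P) * (1 + \<bar>s\<bar>)) * (\<Sum>j\<le>n. \<bar>y j - z j\<bar>)" for y z i
  proof -
    have "\<bar>q y i - q z i\<bar> = \<bar>\<Sum>v\<in>P. (w v y - w v z) * f v i\<bar>"
      by (simp add: q_def algebra_simps sum_subtractf)
    also have "\<dots> \<le> (\<Sum>v\<in>P. \<bar>w v y - w v z\<bar>)"
      using abs_coord_le_1[OF fS] P by (intro order_trans[OF sum_abs] sum_mono)
         (auto simp: abs_mult intro!: mult_left_le)
    also have "\<dots> \<le> (\<Sum>v\<in>P. (1 + \<bar>s\<bar>) * (\<Sum>j\<le>n. \<bar>y j - z j\<bar>))"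
      by (intro sum_mono w_lip)
    finally show ?thesis by simp
  qed
  have q_hom: "q (\<lambda>j. c * y j) i = c * q y i" if "c \<ge> 0" for c y i
  proof -
    have "w v (\<lambda>j. c * y j) = c * w v y" for v
    proof -
      have "sqrt (c * (c * ip n y y)) = c * sqrt (ip n y y)"
        using that by (simp add: real_sqrt_mult flip: mult.assoc)
      then have "w v (\<lambda>j. c * y j) = max (c * 0) (c * (ip n y v - s * sqrt (ip n y y)))"
        by (simp add: w_def ip_linear algebra_simps)
      then show ?thesis
        unfolding w_def using max_mult_distrib_left[of c 0 "ip n y v - s * sqrt (ip n y y)"] that by simp
    qed
    then show ?thesis by (simp add: q_def sum_distrib_left mult.assoc)
  qed
  have inj: "inj_on antipode P"
    by (intro inj_onI) (metis antipode_antipode)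
  have q_odd: "q (\<lambda>j. - y j) i = - q y i" for y i
  proof -
    have "q (\<lambda>j. - y j) i = (\<Sum>v\<in>antipode ` P. w v (\<lambda>j. - y j) * f v i)"
      by (simp add: q_def P)
    also have "\<dots> = (\<Sum>v\<in>P. w (antipode v) (\<lambda>j. - y j) * f (antipode v) i)"
      by (simp add: sum.reindex[OF inj])
    also have "\<dots> = (\<Sum>v\<in>P. - (w v y * f v i))"
    proof (rule sum.cong)
      fix v assume "v \<in> P"
      then have "f (antipode v) i = - f v i"
        using P odd by (auto simp: antipode_def)
      then show "w (antipode v) (\<lambda>j. - y j) * f (antipode v) i = - (w v y * f v i)"
        by (simp add: w_def ip_linear)
    qed simp
    finally show ?thesis by (simp add: q_def sum_negf)
  qed
  have q_f: "ip n (q x) (f x) > 0" if x: "x \<in> sph n" for x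
  proof -
    have eq: "ip n (q x) (f x) = (\<Sum>v\<in>P. w v x * ip n (f v) (f x))"
      unfolding q_def by (rule ip_sum_left)
    have nn: "0 \<le> w v x * ip n (f v) (f x)" if "v \<in> P" for v
    proof (cases "ip n x v > s")
      case True
      then have "ip n (f v) (f x) > 0" using s(2) x P that by blast
      then show ?thesis by (simp add: w_def)
    next
      case False
      then show ?thesis using x by (simp add: w_def sph_iff)
    qed
    obtain p where p: "p \<in> P" "ip n x p > s" using net[OF x] by blast
    then have "0 < w p x * ip n (f p) (f x)"
      using s(2)[of x p] x P by (auto simp: w_def sph_iff)
    then show ?thesis
      unfolding eq using nn p(1) P(1) by (intro sum_pos2[of P p]) auto
  qed
  have q_cont: "continuous_map (nsphere n) euclideanreal (\<lambda>x. q x i)" for i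
    unfolding q_def w_def by (intro continuous_intros continuous_map_nsphere_projection) (auto simp: P)
  have "continuous_on (sph n) (\<lambda>x. ip n (q x) (q x))"
  proof -
    have "continuous_map (top_of_set (sph n)) euclideanreal (\<lambda>x. q x i)" for i
      using q_cont by (simp flip: nsphere_top_of_set)
    then show ?thesis by (intro continuous_on_ip) simp_all
  qed
  moreover have "sph n \<noteq> {}" using in_topspace_nsphere by blast
  ultimately obtain x0 where x0: "x0 \<in> sph n" "\<forall>x\<in>sph n. ip n (q x0) (q x0) \<le> ip n (q x) (q x)"
    using continuous_attains_inf[OF compact_sph, of n "\<lambda>x. ip n (q x) (q x)"] by metis
  have "ip n (q x0) (q x0) > 0"
  proof (rule ccontr)
    assume "\<not> ?thesis"
    then have "ip n (q x0) (q x0) = 0" using ip_self_ge_0[of n "q x0"] by simp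
    then have "ip n (q x0) (f x0) = 0" by (simp add: ip_self_eq_0_iff) (simp add: ip_def)
    with q_f[OF x0(1)] show False by simp
  qed
  note pos = this
  show ?thesis
  proof (rule that[OF q_lip q_hom q_odd pos _ q_f q_cont])
    show "ip n (q x0) (q x0) \<le> ip n (q x) (q x)" if "x \<in> sph n" for x
      using x0(2) that by blast
  qed
qed

text \<open>
  The approximation of \<open>f\<close>, restricted to the equator, misses a pair of opposite directions
  \<open>\<plusminus>a\<close>. A reflection moves \<open>a\<close> to the pole, and then the last coordinate can be shrunk to zero
  along the equator without creating a zero of the map.
\<close>
lemma odd_map_homotopic_equator_preserving:
  assumes n: "n > 0"
    and f: "continuous_map (nsphere n) (nsphere n) f"
    and odd: "\<And>x. x \<in> sph n \<Longrightarrow> f (antipode x) = antipode (f x)"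
  obtains w F where
    "continuous_map (nsphere n) (nsphere n) (reflect n w)"
    "homotopic_with (\<lambda>x. True) (nsphere n) (nsphere n) (reflect n w \<circ> f) F"
    "\<And>x. x \<in> sph n \<Longrightarrow> F (antipode x) = antipode (F x)"
    "\<And>x. \<lbrakk>x \<in> sph n; x n = 0\<rbrakk> \<Longrightarrow> F x n = 0"
proof -
  have fS: "\<And>x. x \<in> sph n \<Longrightarrow> f x \<in> sph n"
    using f by (auto simp: continuous_map_nsphere_iff)
  obtain q L \<kappa> where lip: "\<And>y z i. \<bar>q y i - q z i\<bar> \<le> L * (\<Sum>j\<le>n. \<bar>y j - z j\<bar>)"
    and hom: "\<And>c y i. c \<ge> 0 \<Longrightarrow> q (\<lambda>j. c * y j) i = c * q y i"
    and qodd: "\<And>y i. q (\<lambda>j. - y j) i = - q y i"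
    and pos: "\<kappa> > 0" "\<And>x. x \<in> sph n \<Longrightarrow> ip n (q x) (q x) \<ge> \<kappa>"
    and q_f: "\<And>x. x \<in> sph n \<Longrightarrow> ip n (q x) (f x) > 0"
    and q_cont: "\<And>i. continuous_map (nsphere n) euclideanreal (\<lambda>x. q x i)"
    using odd_map_lipschitz_approximation[OF f odd] by blast
  obtain a where a: "a \<in> sph n" "\<And>x c. \<lbrakk>x \<in> sph n; x n = 0\<rbrakk> \<Longrightarrow> \<exists>i\<le>n. q x i \<noteq> c * a i"
    using homogeneous_lipschitz_misses_direction[OF lip hom qodd pos] by blast
  define e where "e = (\<lambda>i::nat. if i = n then 1 else 0::real)"
  have e: "e \<in> sph n" by (simp add: sph_iff ip_def e_def if_distrib cong: if_cong)
  define w where "w = (\<lambda>i. a i - e i)"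
  have re: "reflect n w e = a" unfolding w_def using a(1) e by (rule reflect_swaps_unit_vectors)
  have r_sph: "reflect n w x \<in> sph n" if "x \<in> sph n" for x
    using that a e ip_reflect[of n w x x] by (auto simp: sph_iff) (simp add: reflect_def w_def sph_iff)
  define G where "G = (\<lambda>x. reflect n w (q x))"
  have G_cont: "continuous_map (nsphere n) euclideanreal (\<lambda>x. G x i)" for i
    unfolding G_def by (intro continuous_map_reflect q_cont)
  have G_nz: "ip n (G x) (G x) > 0" if "x \<in> sph n" for x
    using pos that by (force simp: G_def ip_reflect)
  define A where "A = (\<lambda>x. \<Sum>i<n. (G x i)\<^sup>2)"
  have A_cont: "continuous_map (nsphere n) euclideanreal A"
    unfolding A_def by (intro continuous_intros G_cont) auto
  have A0: "A x \<ge> 0" for x by (simp add: A_def sum_nonneg)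
  have A_equator: "A x \<noteq> 0" if x: "x \<in> sph n" "x n = 0" for x
  proof
    assume "A x = 0"
    then have G0: "\<forall>i<n. G x i = 0"
      unfolding A_def by (subst (asm) sum_nonneg_eq_0_iff) auto
    have "q x i = G x n * a i" if "i \<le> n" for i
    proof -
      have "q x = reflect n w (G x)" by (simp add: G_def reflect_reflect)
      then have "q x i = reflect n w (G x) i" by simp
      also have "\<dots> = reflect n w (\<lambda>j. G x n * e j) i"
        using G0 that by (intro reflect_cong) (auto simp: e_def)
      also have "\<dots> = G x n * a i"
        by (simp only: reflect_scale re)
      finally show ?thesis .
    qed
    with a(2)[OF x] show False by blast
  qed
  \<comment> \<open>\<open>l\<close> is 1 on the equator and 0 where all coordinates of \<open>G x\<close> but the last vanish; the
    denominator is nonzero because these two sets are disjoint.\<close>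
  define l where "l = (\<lambda>x. A x / (A x + (x n)\<^sup>2))"
  have den: "A x + (x n)\<^sup>2 \<noteq> 0" if "x \<in> sph n" for x
    using A_equator[OF that] A0[of x] by (cases "x n = 0") (auto simp: add_nonneg_eq_0_iff)
  define H where "H = (\<lambda>x i. if i = n then (1 - l x) * G x i else G x i)"
  have H_cont: "continuous_map (nsphere n) euclideanreal (\<lambda>x. H x i)" for i
  proof -
    have "continuous_map (nsphere n) euclideanreal l"
      unfolding l_def
      by (intro continuous_intros A_cont continuous_map_nsphere_projection) (use den in auto)
    then show ?thesis
      unfolding H_def by (cases "i = n") (auto intro!: continuous_intros G_cont)
  qed
  define F where "F = (\<lambda>x. unit_vec n (H x))"
  have GH_nz: "\<exists>i\<le>n. (1 - t) * G x i + t * H x i \<noteq> 0" if x: "x \<in> sph n" for x t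
  proof (rule ccontr)
    assume no: "\<not> ?thesis"
    have G0: "G x i = 0" if "i < n" for i
    proof -
      have "(1 - t) * G x i + t * H x i = G x i" using that by (simp add: H_def algebra_simps)
      then show ?thesis using no that by auto
    qed
    then have "A x = 0" by (simp add: A_def)
    then have "H x n = G x n" by (simp add: H_def l_def)
    then have "(1 - t) * G x n + t * H x n = G x n" by (simp add: algebra_simps)
    then have "G x n = 0" using no by auto
    with G0 have "ip n (G x) (G x) = 0" by (auto simp: ip_self_eq_0_iff le_less)
    with G_nz[OF x] show False by simp
  qed
  have f_cont: "continuous_map (nsphere n) euclideanreal (\<lambda>x. reflect n w (f x) i)" for i
    using continuous_map_reflect[of "nsphere n" f n w i] continuous_map_coordinate[OF f] by blast
  have "homotopic_with (\<lambda>x. True) (nsphere n) (nsphere n)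
      (\<lambda>x. unit_vec n (reflect n w (f x))) (\<lambda>x. unit_vec n (G x))"
  proof (rule homotopic_unit_vec[OF f_cont G_cont])
    fix x t assume x: "x \<in> topspace (nsphere n)" and t: "0 \<le> t" "t \<le> (1::real)"
    show "\<exists>i\<le>n. (1 - t) * reflect n w (f x) i + t * G x i \<noteq> 0"
    proof (rule ccontr)
      assume "\<not> ?thesis"
      then have "ip n (\<lambda>i. (1 - t) * reflect n w (f x) i + t * G x i) (reflect n w (f x)) = 0"
        by (simp add: ip_def)
      then have "(1 - t) * ip n (f x) (f x) + t * ip n (q x) (f x) = 0"
        by (simp only: G_def ip_linear ip_reflect)
      moreover have "ip n (f x) (f x) = 1" using fS[OF x] by (simp add: sph_iff)
      moreover have "t * ip n (q x) (f x) \<ge> 0" using q_f[OF x] t by simp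
      ultimately have "t = 1" using t by auto
      with \<open>(1 - t) * ip n (f x) (f x) + t * ip n (q x) (f x) = 0\<close> q_f[OF x] show False by simp
    qed
  qed
  moreover have "homotopic_with (\<lambda>x. True) (nsphere n) (nsphere n) (\<lambda>x. unit_vec n (G x)) F"
    unfolding F_def by (rule homotopic_unit_vec[OF G_cont H_cont GH_nz])
  ultimately have 1: "homotopic_with (\<lambda>x. True) (nsphere n) (nsphere n)
      (\<lambda>x. unit_vec n (reflect n w (f x))) F"
    by (rule homotopic_with_trans)
  have "unit_vec n (reflect n w (f x)) = (reflect n w \<circ> f) x" if "x \<in> sph n" for x
    using unit_vec_id[OF r_sph[OF fS[OF that]]] by simp
  then have 2: "homotopic_with (\<lambda>x. True) (nsphere n) (nsphere n) (reflect n w \<circ> f) F"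
    by (intro homotopic_with_eq[OF 1]) auto
  show ?thesis
  proof (rule that[OF _ 2])
    show "continuous_map (nsphere n) (nsphere n) (reflect n w)"
      using continuous_map_reflect[of "nsphere n" "\<lambda>x. x"] continuous_map_nsphere_projection r_sph
      by (intro continuous_map_into_sphere) auto
    show "F (antipode x) = antipode (F x)" if "x \<in> sph n" for x
    proof -
      have "q (antipode x) = (\<lambda>i. - q x i)" using qodd by (auto simp: antipode_def)
      then have "q (antipode x) = (\<lambda>i. (-1) * q x i)" by simp
      then have "G (antipode x) = (\<lambda>i. - G x i)"
        unfolding G_def by (simp only: reflect_scale) simp
      then have "H (antipode x) = (\<lambda>i. - H x i)"
        by (auto simp: H_def l_def A_def antipode_def)
      then show ?thesis by (simp add: F_def unit_vec_uminus)
    qed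
    show "F x n = 0" if "x \<in> sph n" "x n = 0" for x
      using A_equator[OF that] that(2) by (simp add: F_def unit_vec_def H_def l_def)
  qed
qed

lemma sph_mono: "m \<le> n \<Longrightarrow> sph m \<subseteq> sph n"
proof
  fix x assume "m \<le> n" "x \<in> sph m"
  then have "ip n x x = ip m x x"
    unfolding ip_def by (intro sum.mono_neutral_right) (auto simp: sph_iff)
  with \<open>x \<in> sph m\<close> \<open>m \<le> n\<close> show "x \<in> sph n" by (auto simp: sph_iff)
qed

lemma continuous_map_subsphere:
  assumes "continuous_map (nsphere n) Y f" "m \<le> n"
  shows "continuous_map (nsphere m) Y f"
proof -
  have "subtopology (nsphere n) (sph m) = nsphere m"
    using sph_mono[OF assms(2)] nsphere_top_of_set[of n] nsphere_top_of_set[of m]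
    by (metis subtopology_subtopology inf.absorb_iff2)
  then show ?thesis using continuous_map_from_subtopology[OF assms(1), of "sph m"] by simp
qed

text \<open>
  Induction on the dimension. The reflection of the previous lemma does no harm, because an odd
  product of degrees has odd factors.
\<close>
theorem Borsuk_odd_degree:
  assumes "continuous_map (nsphere n) (nsphere n) f"
    and "\<And>x. x \<in> sph n \<Longrightarrow> f (antipode x) = antipode (f x)"
  shows "odd (Brouwer_degree2 n f)"
  using assms
proof (induction n arbitrary: f)
  case 0
  define e where "e = (\<lambda>i::nat. if i = 0 then 1 else 0::real)"
  have sph0: "x \<in> sph 0 \<longleftrightarrow> x = e \<or> x = antipode e" for x
    by (auto simp: sph_iff ip_def e_def antipode_def square_eq_1_iff fun_eq_iff)
  have fe: "f e = e \<or> f e = antipode e"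
    using 0(1) sph0 by (auto simp: continuous_map_nsphere_iff)
  then show ?case
  proof
    assume "f e = e"
    then have "f x = id x" if "x \<in> sph 0" for x
      using 0(2)[of e] sph0 that by auto
    then have "Brouwer_degree2 0 f = Brouwer_degree2 0 id" by (rule Brouwer_degree2_eq)
    then show ?thesis by simp
  next
    assume "f e = antipode e"
    then have "f x = (\<lambda>i. if i = 0 then - x i else x i)" if "x \<in> sph 0" for x
      using 0(2)[of e] sph0[of x] sph0[of e] that by (auto simp: antipode_def e_def)
    then have "Brouwer_degree2 0 f = Brouwer_degree2 0 (\<lambda>x i. if i = 0 then - x i else x i)"
      by (rule Brouwer_degree2_eq)
    then show ?thesis by (simp add: Brouwer_degree2_reflection)
  qed
next
  case (Suc n)
  obtain w F where r: "continuous_map (nsphere (Suc n)) (nsphere (Suc n)) (reflect (Suc n) w)"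
    and hom: "homotopic_with (\<lambda>x. True) (nsphere (Suc n)) (nsphere (Suc n)) (reflect (Suc n) w \<circ> f) F"
    and Fodd: "\<And>x. x \<in> sph (Suc n) \<Longrightarrow> F (antipode x) = antipode (F x)"
    and Feq: "\<And>x. \<lbrakk>x \<in> sph (Suc n); x (Suc n) = 0\<rbrakk> \<Longrightarrow> F x (Suc n) = 0"
    using odd_map_homotopic_equator_preserving[OF _ Suc.prems] by blast
  have F: "continuous_map (nsphere (Suc n)) (nsphere (Suc n)) F"
    using homotopic_with_imp_continuous_maps[OF hom] by blast
  have Fim: "F \<in> sph n \<rightarrow> sph n"
  proof
    fix x assume x: "x \<in> sph n"
    then have x': "x \<in> sph (Suc n)" using sph_mono[of n "Suc n"] by auto
    then have "F x \<in> sph (Suc n)" using F by (auto simp: continuous_map_nsphere_iff)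
    moreover have "F x (Suc n) = 0" using Feq x x' by (simp add: sph_iff)
    ultimately show "F x \<in> sph n" using topspace_nsphere_minus1[of "F x" "Suc n"] by simp
  qed
  have "even (Brouwer_degree2 (Suc n) F - Brouwer_degree2 (Suc n - Suc 0) F)"
  proof (rule Borsuk_odd_mapping_degree_step[OF F])
    fix x assume "x \<in> topspace (nsphere (Suc n))"
    from Fodd[OF this] show "(F \<circ> (\<lambda>x i. - x i)) x = ((\<lambda>x i. - x i) \<circ> F) x"
      by (simp add: antipode_def)
  qed (use Fim in simp)
  moreover have "odd (Brouwer_degree2 n F)"
  proof (rule Suc.IH)
    have "continuous_map (nsphere n) (nsphere (Suc n)) F"
      using F by (rule continuous_map_subsphere) simp
    then show "continuous_map (nsphere n) (nsphere n) F"
      using Fim continuous_map_coordinate by (intro continuous_map_into_sphere) (blast, fast)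
    show "F (antipode x) = antipode (F x)" if "x \<in> sph n" for x
      using Fodd that sph_mono[of n "Suc n"] by auto
  qed
  ultimately have "odd (Brouwer_degree2 (Suc n) F)" by simp
  also have "Brouwer_degree2 (Suc n) F = Brouwer_degree2 (Suc n) (reflect (Suc n) w \<circ> f)"
    using Brouwer_degree2_homotopic[OF hom] by simp
  also have "\<dots> = Brouwer_degree2 (Suc n) (reflect (Suc n) w) * Brouwer_degree2 (Suc n) f"
    by (rule Brouwer_degree2_compose[OF Suc.prems(1) r])
  finally show ?case by simp
qed

text \<open>
  If \<open>m < n\<close>, then the restriction of \<open>f\<close> to the \<open>m\<close>-sphere extends over a hemisphere of the
  \<open>(m+1)\<close>-sphere. So this restriction is nullhomotopic and has degree 0, which is not odd.
\<close>
theorem Borsuk_Ulam: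
  assumes f: "continuous_map (nsphere n) (nsphere m) f"
    and odd: "\<And>x. x \<in> sph n \<Longrightarrow> f (antipode x) = antipode (f x)"
  shows "n \<le> m"
proof (rule ccontr)
  assume "\<not> n \<le> m"
  then have mn: "Suc m \<le> n" "m \<le> n" by auto
  have cf: "continuous_map (nsphere (Suc m)) (nsphere m) f"
    using continuous_map_subsphere[OF f mn(1)] .
  define e where "e = (\<lambda>i::nat. if i = Suc m then 1 else 0::real)"
  have "homotopic_with (\<lambda>x. True) (nsphere m) (nsphere (Suc m))
          (\<lambda>x. unit_vec (Suc m) x) (\<lambda>x. unit_vec (Suc m) e)"
  proof (rule homotopic_unit_vec)
    fix x t assume x: "x \<in> topspace (nsphere m)" 
    show "\<exists>i\<le>Suc m. (1 - t) * x i + t * e i \<noteq> (0::real)"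
    proof (cases "t = 0")
      case True
      have "ip m x x \<noteq> 0" using x by (simp add: sph_iff)
      then obtain i where "i \<le> m" "x i \<noteq> 0" by (auto simp: ip_self_eq_0_iff)
      then show ?thesis using True by (intro exI[of _ i]) auto
    next
      case False
      then show ?thesis using x by (intro exI[of _ "Suc m"]) (simp add: sph_iff e_def)
    qed
  qed (auto simp: continuous_map_nsphere_projection)
  then have "homotopic_with (\<lambda>x. True) (nsphere m) (nsphere m)
          (f \<circ> (\<lambda>x. unit_vec (Suc m) x)) (f \<circ> (\<lambda>x. unit_vec (Suc m) e))"
    by (rule homotopic_with_compose_continuous_map_left[OF _ cf]) auto
  then have "homotopic_with (\<lambda>x. True) (nsphere m) (nsphere m) f (\<lambda>x. f (unit_vec (Suc m) e))"
  proof (rule homotopic_with_eq)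
    fix x assume "x \<in> topspace (nsphere m)"
    then have "x \<in> sph (Suc m)" using sph_mono[of m "Suc m"] by auto
    then show "f x = (f \<circ> unit_vec (Suc m)) x" by (simp add: unit_vec_id)
  qed auto
  then have "Brouwer_degree2 m f = 0" by (rule Brouwer_degree2_nullhomotopic)
  moreover have "odd (Brouwer_degree2 m f)"
    using continuous_map_subsphere[OF f mn(2)] odd sph_mono[OF mn(2)]
    by (intro Borsuk_odd_degree) auto
  ultimately show False by simp
qed

section \<open>Maps from and into geometric realizations\<close>

lemma continuous_map_from_realization:
  assumes "\<And>\<sigma>. \<sigma> \<in> K \<Longrightarrow> continuous_map (subtopology (powertop_real UNIV) (closed_simplex \<sigma>)) Y g"
  shows "continuous_map (geometric_realization K) Y g"
  unfolding continuous_map_def topspace_geometric_realization openin_geometric_realization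
proof (intro conjI allI impI)
  show "g \<in> realization_carrier K \<rightarrow> topspace Y"
    using assms by (fastforce simp: realization_carrier_def continuous_map_def)
  fix U assume U: "openin Y U"
  show "weakly_open K {t \<in> realization_carrier K. g t \<in> U}"
    unfolding weakly_open_def
  proof (intro conjI ballI)
    fix \<sigma> assume \<sigma>: "\<sigma> \<in> K"
    have "{t \<in> realization_carrier K. g t \<in> U} \<inter> closed_simplex \<sigma> = {t \<in> closed_simplex \<sigma>. g t \<in> U}"
      using \<sigma> by (auto simp: realization_carrier_def)
    moreover have "openin (subtopology (powertop_real UNIV) (closed_simplex \<sigma>)) {t \<in> closed_simplex \<sigma>. g t \<in> U}"
      using openin_continuous_map_preimage[OF assms[OF \<sigma>] U] by simp
    ultimately show "openin (subtopology (powertop_real UNIV) (closed_simplex \<sigma>))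
        ({t \<in> realization_carrier K. g t \<in> U} \<inter> closed_simplex \<sigma>)" by simp
  qed auto
qed

lemma closed_closed_simplex: "closed (closed_simplex \<sigma>)"
proof -
  have "closed_simplex \<sigma> = (\<Inter>v. {t. 0 \<le> t v}) \<inter> (\<Inter>v\<in>-\<sigma>. {t. t v = 0}) \<inter> {t. (\<Sum>v\<in>\<sigma>. t v) = 1}"
    by (auto simp: closed_simplex_def)
  moreover have "closed \<dots>"
    by (intro closed_Int closed_INT ballI closed_Collect_eq closed_Collect_le continuous_intros
          continuous_on_product_coordinates)
  ultimately show ?thesis by simp
qed

text \<open>
  The weak topology is finer than the topology of coordinatewise convergence, so coordinatewise
  continuity alone does not suffice. It does when finitely many simplices contain the image: the
  preimage of a closed set is then a finite union of closed sets, one for each simplex.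
\<close>
lemma continuous_map_into_realization:
  assumes coord: "\<And>v. continuous_map X euclideanreal (\<lambda>x. f x v)"
    and F: "finite F" "F \<subseteq> K"
    and mem: "\<And>x. x \<in> topspace X \<Longrightarrow> \<exists>\<sigma>\<in>F. f x \<in> closed_simplex \<sigma>"
  shows "continuous_map X (geometric_realization K) f"
  unfolding continuous_map_closedin topspace_geometric_realization
proof (intro conjI allI impI ballI)
  show "f \<in> topspace X \<rightarrow> realization_carrier K"
    using mem F(2) by (fastforce simp: realization_carrier_def)
  fix C assume C: "closedin (geometric_realization K) C"
  have f: "continuous_map X (powertop_real UNIV) f"
    using coord by (simp add: continuous_map_componentwise_UNIV)
  have cl: "closedin (powertop_real UNIV) (C \<inter> closed_simplex \<sigma>)" if "\<sigma> \<in> K" for \<sigma>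
  proof -
    have sub: "closed_simplex \<sigma> \<subseteq> realization_carrier K"
      using that by (auto simp: realization_carrier_def)
    have "weakly_open K (realization_carrier K - C)"
      using C by (simp add: closedin_def topspace_geometric_realization openin_geometric_realization)
    then have "openin (subtopology (powertop_real UNIV) (closed_simplex \<sigma>)) 
        ((realization_carrier K - C) \<inter> closed_simplex \<sigma>)"
      using that by (simp add: weakly_open_def)
    moreover have "(realization_carrier K - C) \<inter> closed_simplex \<sigma> = closed_simplex \<sigma> - C \<inter> closed_simplex \<sigma>"
      using sub by blast
    ultimately have "closedin (subtopology (powertop_real UNIV) (closed_simplex \<sigma>)) (C \<inter> closed_simplex \<sigma>)"
      by (simp add: closedin_def)
    moreover have "closedin (powertop_real UNIV) (closed_simplex \<sigma>)"
      by (simp add: euclidean_product_topology closed_closed_simplex)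
    ultimately show ?thesis by (rule closedin_trans_full)
  qed
  have "{x \<in> topspace X. f x \<in> C} = (\<Union>\<sigma>\<in>F. {x \<in> topspace X. f x \<in> C \<inter> closed_simplex \<sigma>})"
    using mem by blast
  moreover have "closedin X \<dots>"
    using F closedin_continuous_map_preimage[OF f cl] by (intro closedin_Union) blast+
  ultimately show "closedin X {x \<in> topspace X. f x \<in> C}" by simp
qed

section \<open>Coindex and simplices of Vietoris--Rips complexes\<close>

lemma enat_le_coindI: "odd_map k X \<tau> f \<Longrightarrow> enat k \<le> coind X \<tau>"
  unfolding coind_def by (intro Sup_upper) auto

lemma sphere_dist_le_iff:
  assumes "x \<in> sph m" "y \<in> sph m" "0 \<le> r" "r \<le> pi"
  shows "sphere_dist m x y \<le> r \<longleftrightarrow> cos r \<le> ip m x y"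
proof -
  have "sphere_dist m x y = arccos (ip m x y)" by (simp add: sphere_dist_def ip_def)
  moreover have "arccos (ip m x y) \<le> r \<longleftrightarrow> cos r \<le> cos (arccos (ip m x y))"
    using assms ip_le_1 ip_ge_minus_1 by (intro cos_mono_le_eq[symmetric]) (auto intro: arccos_lbound arccos_ubound)
  ultimately show ?thesis
    using assms ip_le_1 ip_ge_minus_1 by (simp add: cos_arccos)
qed

lemma VR_simplex_iff:
  assumes "0 \<le> r" "r \<le> pi"
  shows "\<sigma> \<in> vietoris_rips (sph m) (sphere_dist m) r \<longleftrightarrow>
    finite \<sigma> \<and> \<sigma> \<noteq> {} \<and> \<sigma> \<subseteq> sph m \<and> (\<forall>x\<in>\<sigma>. \<forall>y\<in>\<sigma>. cos r \<le> ip m x y)"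
  unfolding vietoris_rips_def using sphere_dist_le_iff[OF _ _ assms] by blast

section \<open>Upper bounds for the coindex\<close>

text \<open>
  The linear extension of \<open>\<phi>\<close>, normalized, is an odd map from the complex to the \<open>N\<close>-sphere.
  Composing it with an odd map from the \<open>k\<close>-sphere gives \<open>k \<le> N\<close> by Borsuk--Ulam.
\<close>
lemma coind_VR_le:
  assumes r: "0 \<le> r" "r \<le> pi"
    and \<phi>_odd: "\<And>v. v \<in> sph m \<Longrightarrow> \<phi> (antipode v) = antipode (\<phi> v)"
    and nz: "\<And>\<sigma> t. \<lbrakk>\<sigma> \<in> vietoris_rips (sph m) (sphere_dist m) r; t \<in> closed_simplex \<sigma>\<rbrakk>
      \<Longrightarrow> \<exists>i\<le>N. (\<Sum>v\<in>\<sigma>. t v * \<phi> v i) \<noteq> 0"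
  shows "coind (VR_sphere m r) VR_antipode \<le> enat N"
proof -
  let ?K = "vietoris_rips (sph m) (sphere_dist m) r"
  define b where "b = (\<lambda>t i. \<Sum>v | t v \<noteq> (0::real). t v * \<phi> v i)"
  have b_eq: "b t i = (\<Sum>v\<in>\<sigma>. t v * \<phi> v i)" if "\<sigma> \<in> ?K" "t \<in> closed_simplex \<sigma>" for \<sigma> t i
    unfolding b_def using that
    by (intro sum.mono_neutral_left) (auto simp: closed_simplex_def VR_simplex_iff[OF r])
  define g where "g = (\<lambda>t. unit_vec N (b t))"
  have "continuous_map (geometric_realization ?K) (nsphere N) g"
  proof (rule continuous_map_from_realization)
    fix \<sigma> assume \<sigma>: "\<sigma> \<in> ?K"
    let ?D = "subtopology (powertop_real UNIV) (closed_simplex \<sigma>)"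
    have "continuous_map ?D (nsphere N) (\<lambda>t. unit_vec N (\<lambda>i. \<Sum>v\<in>\<sigma>. t v * \<phi> v i))"
    proof (rule continuous_map_unit_vec)
      have "finite \<sigma>" using \<sigma> by (simp add: VR_simplex_iff[OF r])
      then show "continuous_map ?D euclideanreal (\<lambda>t. \<Sum>v\<in>\<sigma>. t v * \<phi> v i)" for i
        by (intro continuous_intros continuous_map_from_subtopology continuous_map_product_projection) auto
    qed (use nz[OF \<sigma>] in \<open>auto simp: ip_self_eq_0_iff\<close>)
    then show "continuous_map ?D (nsphere N) g"
      by (rule continuous_map_eq) (use b_eq[OF \<sigma>] in \<open>auto simp: g_def intro!: arg_cong[where f = "unit_vec N"]\<close>)
  qed
  then have g: "continuous_map (VR_sphere m r) (nsphere N) g" by (simp add: VR_sphere_def)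
  have g_odd: "g (VR_antipode t) = antipode (g t)" if "t \<in> topspace (VR_sphere m r)" for t
  proof -
    obtain \<sigma> where \<sigma>: "\<sigma> \<in> ?K" "t \<in> closed_simplex \<sigma>"
      using \<open>t \<in> _\<close> by (auto simp: VR_sphere_def topspace_geometric_realization realization_carrier_def)
    have supp: "{v. t v \<noteq> 0} \<subseteq> sph m"
      using \<sigma> by (auto simp: closed_simplex_def VR_simplex_iff[OF r])
    have eq: "{v. VR_antipode t v \<noteq> 0} = antipode ` {v. t v \<noteq> 0}"
      by (auto simp: VR_antipode_def image_iff) (metis antipode_antipode)
    have inj: "inj_on antipode A" for A
      by (intro inj_onI) (metis antipode_antipode)
    have "b (VR_antipode t) i = - b t i" for i
    proof -
      have "b (VR_antipode t) i = (\<Sum>v | t v \<noteq> 0. t v * \<phi> (antipode v) i)"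
        unfolding b_def eq by (subst sum.reindex[OF inj]) (simp add: VR_antipode_def)
      also have "\<dots> = (\<Sum>v | t v \<noteq> 0. - (t v * \<phi> v i))"
      proof (rule sum.cong)
        fix v assume "v \<in> {v. t v \<noteq> 0}"
        then have "\<phi> (antipode v) i = - \<phi> v i" using \<phi>_odd[of v] supp by (auto simp: antipode_def)
        then show "t v * \<phi> (antipode v) i = - (t v * \<phi> v i)" by simp
      qed simp
      finally show ?thesis by (simp add: b_def sum_negf)
    qed
    then have "b (VR_antipode t) = (\<lambda>i. - b t i)" by auto
    then show ?thesis by (simp add: g_def unit_vec_uminus)
  qed
  have "k \<le> N" if "odd_map k (VR_sphere m r) VR_antipode f" for k f
  proof (rule Borsuk_Ulam)
    have f: "continuous_map (nsphere k) (VR_sphere m r) f"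
      and f_odd: "\<And>x. x \<in> sph k \<Longrightarrow> f (antipode x) = VR_antipode (f x)"
      using that by (auto simp: odd_map_def)
    show "continuous_map (nsphere k) (nsphere N) (g \<circ> f)"
      using f g by (rule continuous_map_compose)
    show "(g \<circ> f) (antipode x) = antipode ((g \<circ> f) x)" if "x \<in> sph k" for x
      using f_odd[OF that] g_odd f that by (auto simp: continuous_map_def)
  qed
  then show ?thesis
    unfolding coind_def by (intro Sup_least) auto
qed

text \<open>
  Suppose that the barycentre is 0, and let \<open>A\<close> be the matrix \<open>\<Sum>v\<in>\<sigma>. t v * (v i * v j)\<close>. Its trace
  is 1, so the trace of \<open>A\<^sup>2\<close> is at least \<open>1 / (m+1)\<close>. On the other hand the trace of \<open>A\<^sup>2\<close> is the
  weighted mean of \<open>(ip m v w)\<^sup>2\<close>. All inner products lie in the interval from \<open>c\<close> to 1 and have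
  weighted mean 0, hence their weighted mean square is at most \<open>- c < 1 / (m+1)\<close>.
\<close>
lemma barycenter_nonzero:
  assumes \<sigma>: "finite \<sigma>" "\<sigma> \<subseteq> sph m"
    and c: "\<And>x y. \<lbrakk>x \<in> \<sigma>; y \<in> \<sigma>\<rbrakk> \<Longrightarrow> c \<le> ip m x y" "c > - 1 / real (m + 1)"
    and t: "t \<in> closed_simplex \<sigma>"
  shows "\<exists>i\<le>m. (\<Sum>v\<in>\<sigma>. t v * v i) \<noteq> 0"
proof (rule ccontr)
  assume "\<not> ?thesis"
  then have b0: "\<And>i. i \<le> m \<Longrightarrow> (\<Sum>v\<in>\<sigma>. t v * v i) = 0" by blast
  have t0: "\<And>v. 0 \<le> t v" and t1: "(\<Sum>v\<in>\<sigma>. t v) = 1"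
    using t by (auto simp: closed_simplex_def)
  have mean0: "(\<Sum>v\<in>\<sigma>. t v * ip m v w) = 0" for w
  proof -
    have "(\<Sum>v\<in>\<sigma>. t v * ip m v w) = ip m (\<lambda>i. \<Sum>v\<in>\<sigma>. t v * v i) w"
      using ip_sum_left[where m = m and P = \<sigma> and w = t and x = "\<lambda>v. v" and z = w] by simp
    also have "\<dots> = 0" using b0 by (simp add: ip_def)
    finally show ?thesis .
  qed
  have row: "(\<Sum>v\<in>\<sigma>. t v * (ip m v w)\<^sup>2) \<le> - c" if w: "w \<in> \<sigma>" for w
  proof -
    have "(ip m v w)\<^sup>2 \<le> (1 + c) * ip m v w - c" if "v \<in> \<sigma>" for v
    proof -
      have "0 \<le> (ip m v w - c) * (1 - ip m v w)"
        using c(1)[OF that w] ip_le_1[of v m w] \<sigma>(2) that w by (intro mult_nonneg_nonneg) auto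
      then show ?thesis by (simp add: algebra_simps power2_eq_square)
    qed
    then have "(\<Sum>v\<in>\<sigma>. t v * (ip m v w)\<^sup>2) \<le> (\<Sum>v\<in>\<sigma>. t v * ((1 + c) * ip m v w - c))"
      by (intro sum_mono mult_left_mono t0)
    also have "\<dots> = (1 + c) * (\<Sum>v\<in>\<sigma>. t v * ip m v w) - c * (\<Sum>v\<in>\<sigma>. t v)"
      by (simp add: algebra_simps sum.distrib sum_subtractf sum_distrib_left)
    finally show ?thesis by (simp add: mean0 t1)
  qed
  have upper: "(\<Sum>w\<in>\<sigma>. t w * (\<Sum>v\<in>\<sigma>. t v * (ip m v w)\<^sup>2)) \<le> - c"
  proof -
    have "(\<Sum>w\<in>\<sigma>. t w * (\<Sum>v\<in>\<sigma>. t v * (ip m v w)\<^sup>2)) \<le> (\<Sum>w\<in>\<sigma>. t w * (- c))"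
      by (intro sum_mono mult_left_mono row t0)
    also have "\<dots> = (\<Sum>w\<in>\<sigma>. t w) * (- c)" by (rule sum_distrib_right[symmetric])
    also have "\<dots> = - c" by (simp add: t1)
    finally show ?thesis .
  qed
  define A where "A = (\<lambda>i j. \<Sum>v\<in>\<sigma>. t v * (v i * v j))"
  have trace: "(\<Sum>i\<le>m. A i i) = 1"
  proof -
    have "(\<Sum>i\<le>m. A i i) = (\<Sum>v\<in>\<sigma>. t v * ip m v v)"
      unfolding A_def ip_def sum_distrib_left by (rule sum.swap)
    also have "\<dots> = (\<Sum>v\<in>\<sigma>. t v)"
      using \<sigma>(2) by (intro sum.cong) (auto simp: sph_iff)
    finally show ?thesis by (simp add: t1)
  qed
  have sq: "(ip m v w)\<^sup>2 = (\<Sum>i\<le>m. \<Sum>j\<le>m. (v i * v j) * (w i * w j))" for v w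
    unfolding ip_def power2_eq_square sum_product by (simp add: mult_ac)
  have "(\<Sum>i\<le>m. \<Sum>j\<le>m. (A i j)\<^sup>2) = (\<Sum>w\<in>\<sigma>. t w * (\<Sum>v\<in>\<sigma>. t v * (ip m v w)\<^sup>2))"
  proof -
    have "(\<Sum>i\<le>m. \<Sum>j\<le>m. (A i j)\<^sup>2) =
        (\<Sum>i\<le>m. \<Sum>j\<le>m. \<Sum>w\<in>\<sigma>. \<Sum>v\<in>\<sigma>. t w * (t v * ((v i * v j) * (w i * w j))))"
      unfolding A_def power2_eq_square sum_product
      by (simp add: mult_ac)
    also have "\<dots> = (\<Sum>i\<le>m. \<Sum>w\<in>\<sigma>. \<Sum>j\<le>m. \<Sum>v\<in>\<sigma>. t w * (t v * ((v i * v j) * (w i * w j))))"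
      by (intro sum.cong refl) (rule sum.swap)
    also have "\<dots> = (\<Sum>w\<in>\<sigma>. \<Sum>i\<le>m. \<Sum>j\<le>m. \<Sum>v\<in>\<sigma>. t w * (t v * ((v i * v j) * (w i * w j))))"
      by (rule sum.swap)
    also have "\<dots> = (\<Sum>w\<in>\<sigma>. \<Sum>i\<le>m. \<Sum>v\<in>\<sigma>. \<Sum>j\<le>m. t w * (t v * ((v i * v j) * (w i * w j))))"
      by (intro sum.cong refl) (rule sum.swap)
    also have "\<dots> = (\<Sum>w\<in>\<sigma>. \<Sum>v\<in>\<sigma>. \<Sum>i\<le>m. \<Sum>j\<le>m. t w * (t v * ((v i * v j) * (w i * w j))))"
      by (intro sum.cong refl) (rule sum.swap)
    finally show ?thesis by (simp add: sq sum_distrib_left)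
  qed
  then have "(\<Sum>i\<le>m. \<Sum>j\<le>m. (A i j)\<^sup>2) \<le> - c" using upper by simp
  moreover have "(\<Sum>i\<le>m. (A i i)\<^sup>2) \<le> (\<Sum>i\<le>m. \<Sum>j\<le>m. (A i j)\<^sup>2)"
    by (intro sum_mono) (auto intro!: member_le_sum[where f = "\<lambda>j. (A _ j)\<^sup>2"])
  moreover have "1 \<le> (\<Sum>i\<le>m. (A i i)\<^sup>2) * real (m + 1)"
    using Cauchy_Schwarz_ineq_sum[of "\<lambda>i. A i i" "\<lambda>_. 1" "{..m}"] trace by simp
  moreover from this have "1 / real (m + 1) \<le> (\<Sum>i\<le>m. (A i i)\<^sup>2)"
    by (subst pos_divide_le_eq) auto
  ultimately have "1 / real (m + 1) \<le> - c" by linarith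
  with c(2) show False by simp
qed

text \<open>
  The scale \<open>arccos (- 1 / (m+1))\<close> is the edge length of the inscribed regular simplex, the first
  one at which the origin is a barycentre of a simplex.
\<close>
lemma coind_VR_le_dim:
  assumes "0 \<le> r" "r \<le> pi" "cos r > - 1 / real (m + 1)"
  shows "coind (VR_sphere m r) VR_antipode \<le> enat m"
proof (rule coind_VR_le[OF assms(1,2), where \<phi> = "\<lambda>v. v"])
  fix \<sigma> t assume "\<sigma> \<in> vietoris_rips (sph m) (sphere_dist m) r" "t \<in> closed_simplex \<sigma>"
  then show "\<exists>i\<le>m. (\<Sum>v\<in>\<sigma>. t v * v i) \<noteq> 0"
    using assms by (intro barycenter_nonzero[where c = "cos r"]) (auto simp: VR_simplex_iff)
qed simp

text \<open>
  For each point \<open>p\<close> of a finite net, the coordinate function is 1 near \<open>p\<close>, -1 near \<open>- p\<close>, and 0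
  elsewhere. A simplex cannot contain nearly antipodal points, so no coordinate takes both
  signs on it. Some coordinate is nonzero at a vertex of positive weight, and therefore
  also in the linear extension.
\<close>
lemma coind_VR_bounded:
  assumes "0 \<le> r'" "r' < pi"
  obtains N where "\<And>r. \<lbrakk>0 \<le> r; r \<le> r'\<rbrakk> \<Longrightarrow> coind (VR_sphere m r) VR_antipode \<le> enat N"
proof -
  have c: "cos r' > -1"
    using assms cos_monotone_0_pi[of r' pi] by simp
  \<comment> \<open>By \<open>caps_meet_ip\<close>, points of a cap of this size have inner product greater than \<open>- cos r'\<close>.\<close>
  define s where "s = 1 - (1 + cos r') / 4"
  have s: "s < 1" "s \<ge> 1 / 2" and s': "1 - 4 * (1 - s) = - cos r'"
    using c cos_le_one[of r'] by (auto simp: s_def field_simps)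
  obtain P where P: "finite P" "P \<subseteq> sph m" and net: "\<And>x. x \<in> sph m \<Longrightarrow> \<exists>p\<in>P. ip m x p > s"
    using symmetric_net[OF s(1), of m] by metis
  obtain p and N :: nat where p: "P = p ` {i. i < N}"
    using finite_imp_nat_seg_image_inj_on[OF P(1)] by auto
  define \<phi> where "\<phi> = (\<lambda>x i. if i < N
      then (if ip m x (p i) > s then 1 else if ip m x (p i) < - s then -1 else 0) else 0::real)"
  show ?thesis
  proof (rule that[of N])
    fix r assume r: "0 \<le> r" "r \<le> r'"
    then have r_pi: "r \<le> pi" using assms by simp
    show "coind (VR_sphere m r) VR_antipode \<le> enat N"
    proof (rule coind_VR_le[OF r(1) r_pi, where \<phi> = \<phi>])
      show "\<phi> (antipode v) = antipode (\<phi> v)" for v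
        using s by (intro ext) (auto simp: \<phi>_def antipode_apply)
      fix \<sigma> t assume \<sigma>: "\<sigma> \<in> vietoris_rips (sph m) (sphere_dist m) r" and t: "t \<in> closed_simplex \<sigma>"
      have \<sigma>': "finite \<sigma>" "\<sigma> \<subseteq> sph m" "\<And>x y. \<lbrakk>x \<in> \<sigma>; y \<in> \<sigma>\<rbrakk> \<Longrightarrow> cos r \<le> ip m x y"
        using \<sigma> by (auto simp: VR_simplex_iff[OF r(1) r_pi])
      have t0: "\<And>v. 0 \<le> t v" and t1: "(\<Sum>v\<in>\<sigma>. t v) = 1"
        using t by (auto simp: closed_simplex_def)
      obtain x where x: "x \<in> \<sigma>" "t x \<noteq> 0"
        using t1 by (metis sum.neutral zero_neq_one)
      obtain i where i: "i < N" "ip m x (p i) > s"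
        using net[of x] x \<sigma>' p by auto
      have piS: "p i \<in> sph m" using p i P by auto
      have nn: "\<phi> y i \<ge> 0" if y: "y \<in> \<sigma>" for y
      proof (rule ccontr)
        assume "\<not> ?thesis"
        then have "ip m y (p i) < - s" using i by (auto simp: \<phi>_def split: if_splits)
        then have "ip m (p i) (antipode y) > s" "ip m (p i) x > s"
          using i by (simp_all add: ip_commute[of m "p i"])
        then have "ip m x (antipode y) > - cos r'"
          using caps_meet_ip[of "p i" m x "antipode y" s] piS x y \<sigma>' s' by auto
        moreover have "cos r' \<le> cos r" using r assms by (intro cos_monotone_0_pi_le) auto
        ultimately show False using \<sigma>'(3)[OF x(1) y] by simp
      qed
      have "0 < t x * \<phi> x i"
        using i x t0[of x] s by (simp add: \<phi>_def)
      then have "0 < (\<Sum>v\<in>\<sigma>. t v * \<phi> v i)"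
        using nn t0 \<sigma>' x by (intro sum_pos2[of \<sigma> x]) auto
      then show "\<exists>i\<le>N. (\<Sum>v\<in>\<sigma>. t v * \<phi> v i) \<noteq> 0"
        using i by (intro exI[of _ i]) auto
    qed
  qed
qed

section \<open>Odd maps into Vietoris--Rips complexes\<close>

text \<open>
  At scale \<open>pi\<close> antipodal points span an edge, whose midpoint is fixed by the action; constant maps
  to it are odd. This shows that the infimum in \<open>coind_threshold\<close> is taken over a nonempty set.
\<close>
lemma coind_VR_pi: "coind (VR_sphere m pi) VR_antipode = \<infinity>"
proof -
  let ?K = "vietoris_rips (sph m) (sphere_dist m) pi"
  define e where "e = (\<lambda>i::nat. if i = 0 then 1 else 0::real)"
  have e: "e \<in> sph m" using in_topspace_nsphere by (simp add: e_def)
  have ne: "e \<noteq> antipode e" by (auto simp: e_def antipode_def fun_eq_iff)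
  have \<sigma>: "{e, antipode e} \<in> ?K"
    using e ip_ge_minus_1[of _ m] ip_le_1[OF e e] by (subst VR_simplex_iff) auto
  define t where "t = (\<lambda>v. if v = e \<or> v = antipode e then 1 / 2 else 0::real)"
  have t: "t \<in> closed_simplex {e, antipode e}"
    using ne by (auto simp: closed_simplex_def t_def)
  have t_inv: "VR_antipode t = t"
  proof
    fix v
    have "antipode v = e \<longleftrightarrow> v = antipode e" "antipode v = antipode e \<longleftrightarrow> v = e"
      by (metis antipode_antipode)+
    then show "VR_antipode t v = t v" by (auto simp: VR_antipode_def t_def)
  qed
  have "odd_map k (VR_sphere m pi) VR_antipode (\<lambda>_. t)" for k
    unfolding odd_map_def VR_sphere_def using \<sigma> t t_inv
    by (auto simp: topspace_geometric_realization realization_carrier_def)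
  then have "enat k \<le> coind (VR_sphere m pi) VR_antipode" for k
    by (rule enat_le_coindI)
  then show ?thesis
    by (metis enat_ord_code(3) enat_iless linorder_not_le less_irrefl enat_ord_simps(4) not_infinity_eq Suc_ile_eq)
qed

text \<open>
  The barycentric coordinates of the image of \<open>x\<close> are a partition of unity indexed by a symmetric
  finite net, supported on caps so small that the net points in the cap around \<open>x\<close> span a simplex.
\<close>
lemma coind_VR_ge_dim:
  assumes \<epsilon>: "0 < \<epsilon>" "\<epsilon> \<le> pi"
  shows "enat m \<le> coind (VR_sphere m \<epsilon>) VR_antipode"
proof -
  let ?K = "vietoris_rips (sph m) (sphere_dist m) \<epsilon>"
  have c: "cos \<epsilon> < 1" using cos_monotone_0_pi[of 0 \<epsilon>] \<epsilon> by simp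
  \<comment> \<open>By \<open>caps_meet_ip\<close>, points of a cap of this size have distance less than \<open>\<epsilon>\<close>.\<close>
  define s where "s = 1 - (1 - cos \<epsilon>) / 4"
  have s: "s < 1" and s': "1 - 4 * (1 - s) = cos \<epsilon>"
    using c by (auto simp: s_def field_simps)
  obtain P where P: "finite P" "P \<subseteq> sph m" "antipode ` P = P"
    and net: "\<And>x. x \<in> sph m \<Longrightarrow> \<exists>p\<in>P. ip m x p > s"
    using symmetric_net[OF s, of m] by metis
  define w where "w = (\<lambda>x v. max 0 (ip m x v - s))"
  define W where "W = (\<lambda>x. \<Sum>v\<in>P. w x v)"
  define f where "f = (\<lambda>x v. if v \<in> P then w x v / W x else 0)"
  have w0: "0 \<le> w x v" for x v by (simp add: w_def)
  have W_pos: "W x > 0" if x: "x \<in> sph m" for x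
  proof -
    obtain p where "p \<in> P" "ip m x p > s" using net[OF x] by blast
    then show ?thesis unfolding W_def using w0 P by (intro sum_pos2[of P p]) (auto simp: w_def)
  qed
  have inP: "antipode v \<in> P \<longleftrightarrow> v \<in> P" for v
    using P(3) by (metis antipode_antipode image_eqI)
  have w_odd: "w (antipode x) v = w x (antipode v)" for x v by (simp add: w_def)
  have W_odd: "W (antipode x) = W x" for x
  proof -
    have "W (antipode x) = (\<Sum>v\<in>P. w x (antipode v))" by (simp add: W_def w_odd)
    also have "\<dots> = (\<Sum>v\<in>antipode ` P. w x v)"
      by (subst sum.reindex) (auto intro!: inj_onI dest: arg_cong[where f = antipode])
    finally show ?thesis by (simp add: P W_def)
  qed
  have "continuous_map (nsphere m) (geometric_realization ?K) f"
  proof (rule continuous_map_into_realization[where F = "{\<sigma> \<in> ?K. \<sigma> \<subseteq> P}"])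
    have "continuous_map (nsphere m) euclideanreal (\<lambda>x. w x v)" for v
      unfolding w_def by (intro continuous_intros continuous_map_nsphere_projection) auto
    then show "continuous_map (nsphere m) euclideanreal (\<lambda>x. f x v)" for v
      unfolding f_def W_def using W_pos P(1)
      by (cases "v \<in> P") (auto intro!: continuous_intros simp: W_def less_imp_neq[symmetric])
    show "finite {\<sigma> \<in> ?K. \<sigma> \<subseteq> P}" using P(1) by simp
    fix x assume x: "x \<in> topspace (nsphere m)"
    define \<sigma> where "\<sigma> = {v \<in> P. ip m x v > s}"
    have "\<sigma> \<in> ?K"
    proof (subst VR_simplex_iff)
      have "cos \<epsilon> \<le> ip m p q" if "p \<in> \<sigma>" "q \<in> \<sigma>" for p q
        using caps_meet_ip[OF x, of p q s] that subsetD[OF P(2)] unfolding s' by (auto simp: \<sigma>_def)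
      then show "finite \<sigma> \<and> \<sigma> \<noteq> {} \<and> \<sigma> \<subseteq> sph m \<and> (\<forall>x\<in>\<sigma>. \<forall>y\<in>\<sigma>. cos \<epsilon> \<le> ip m x y)"
        using P net[OF x] by (auto simp: \<sigma>_def)
    qed (use \<epsilon> in auto)
    moreover have "f x \<in> closed_simplex \<sigma>"
    proof -
      have "(\<Sum>v\<in>\<sigma>. f x v) = (\<Sum>v\<in>P. f x v)"
        using P(1) by (intro sum.mono_neutral_left) (auto simp: \<sigma>_def f_def w_def)
      also have "\<dots> = (\<Sum>v\<in>P. w x v / W x)" by (simp add: f_def)
      also have "\<dots> = 1" using W_pos[OF x] by (simp add: W_def flip: sum_divide_distrib)
      finally show ?thesis
        using w0 W_pos[OF x] by (auto simp: closed_simplex_def \<sigma>_def f_def w_def)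
    qed
    ultimately show "\<exists>\<sigma>\<in>{\<sigma> \<in> ?K. \<sigma> \<subseteq> P}. f x \<in> closed_simplex \<sigma>"
      by (auto simp: \<sigma>_def)
  qed auto
  moreover have "f (antipode x) = VR_antipode (f x)" for x
    by (auto simp: f_def VR_antipode_def inP w_odd W_odd)
  ultimately show ?thesis
    by (intro enat_le_coindI[where f = f]) (simp add: odd_map_def VR_sphere_def)
qed

text \<open>
  The \<open>n\<close>-sphere is the boundary of the cross-polytope: a point \<open>x\<close> is sent to the combination of
  the vertices \<open>v i\<close> (where \<open>x i \<ge> 0\<close>) and \<open>- v i\<close> (where \<open>x i < 0\<close>) with weights \<open>\<bar>x i\<bar>\<close>,
  normalized to sum 1.
\<close>
lemma coind_VR_ge_of_nearly_orthogonal: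
  assumes r: "0 \<le> r" "r \<le> pi"
    and v: "\<And>i. i \<le> n \<Longrightarrow> v i \<in> sph m"
    and near_orth: "\<And>i j. \<lbrakk>i \<le> n; j \<le> n; i \<noteq> j\<rbrakk> \<Longrightarrow> \<bar>ip m (v i) (v j)\<bar> \<le> - cos r"
  shows "enat n \<le> coind (VR_sphere m r) VR_antipode"
proof -
  let ?K = "vietoris_rips (sph m) (sphere_dist m) r"
  define u where "u = (\<lambda>S i. if i \<in> S then v i else antipode (v i))"
  define F where "F = (\<lambda>S. u S ` {..n}) ` Pow {..n}"
  have "F \<subseteq> ?K"
  proof
    fix \<sigma> assume "\<sigma> \<in> F"
    then obtain S where \<sigma>: "\<sigma> = u S ` {..n}" by (auto simp: F_def)
    have "u S i \<in> sph m" if "i \<le> n" for i using v[OF that] by (simp add: u_def)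
    moreover have "cos r \<le> ip m (u S i) (u S j)" if "i \<le> n" "j \<le> n" for i j
    proof (cases "i = j")
      case True
      then have "ip m (u S i) (u S j) = 1" using v[OF that(1)] by (simp add: u_def sph_iff)
      then show ?thesis by simp
    next
      case False
      then show ?thesis using near_orth[OF that False] by (auto simp: u_def)
    qed
    ultimately show "\<sigma> \<in> ?K" by (auto simp: VR_simplex_iff[OF r] \<sigma>)
  qed
  define W where "W = (\<lambda>x::nat\<Rightarrow>real. \<Sum>i\<le>n. \<bar>x i\<bar>)"
  define f where "f = (\<lambda>x y. (\<Sum>i\<le>n. (if y = v i then max 0 (x i) else 0) +
      (if y = antipode (v i) then max 0 (- x i) else 0)) / W x)"
  have W_pos: "W x > 0" if "x \<in> sph n" for x
  proof -
    have "ip n x x \<noteq> 0" using that by (simp add: sph_iff)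
    then obtain i where "i \<le> n" "x i \<noteq> 0" by (auto simp: ip_self_eq_0_iff)
    then show ?thesis unfolding W_def by (intro sum_pos2[of _ i]) auto
  qed
  have "continuous_map (nsphere n) (geometric_realization ?K) f"
  proof (rule continuous_map_into_realization[OF _ _ \<open>F \<subseteq> ?K\<close>])
    show "continuous_map (nsphere n) euclideanreal (\<lambda>x. f x y)" for y
    proof -
      have "continuous_map (nsphere n) euclideanreal (\<lambda>x. if y = z then max 0 (x i) else 0)"
        "continuous_map (nsphere n) euclideanreal (\<lambda>x. if y = z then max 0 (- x i) else 0)" for z i
        by (cases "y = z"; auto intro!: continuous_intros continuous_map_nsphere_projection)+
      moreover have "continuous_map (nsphere n) euclideanreal W"
        unfolding W_def by (intro continuous_intros continuous_map_nsphere_projection) auto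
      ultimately show ?thesis
        unfolding f_def using W_pos
        by (intro continuous_map_real_divide continuous_map_sum continuous_map_add)
           (auto simp: less_imp_neq[symmetric])
    qed
    show "finite F" by (simp add: F_def)
    fix x assume x: "x \<in> topspace (nsphere n)"
    define S where "S = {i. i \<le> n \<and> x i \<ge> 0}"
    have fx: "f x y = (\<Sum>i\<le>n. if y = u S i then \<bar>x i\<bar> else 0) / W x" for y
      unfolding f_def by (intro arg_cong2[where f = "(/)"] sum.cong refl) (auto simp: u_def S_def)
    have "(\<Sum>y\<in>u S ` {..n}. f x y) = (\<Sum>i\<le>n. \<Sum>y\<in>u S ` {..n}. if y = u S i then \<bar>x i\<bar> else 0) / W x"
      unfolding fx by (subst sum.swap) (simp add: sum_divide_distrib)
    also have "(\<Sum>i\<le>n. \<Sum>y\<in>u S ` {..n}. if y = u S i then \<bar>x i\<bar> else 0) = W x"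
      unfolding W_def by (intro sum.cong refl) simp
    also have "W x / W x = 1" using W_pos[OF x] by simp
    finally have "f x \<in> closed_simplex (u S ` {..n})"
      using W_pos[OF x] by (auto simp: closed_simplex_def fx intro!: divide_nonneg_pos sum_nonneg sum.neutral)
    moreover have "u S ` {..n} \<in> F" unfolding F_def S_def by blast
    ultimately show "\<exists>\<sigma>\<in>F. f x \<in> closed_simplex \<sigma>" by blast
  qed
  moreover have "f (antipode x) = VR_antipode (f x)" for x
  proof
    fix y
    have "y = antipode z \<longleftrightarrow> antipode y = z" for z by auto
    then have "(y = v i) = (antipode y = antipode (v i))" "(y = antipode (v i)) = (antipode y = v i)" for i
      by (metis antipode_antipode)+
    then show "f (antipode x) y = VR_antipode (f x) y"
      by (simp add: f_def VR_antipode_def W_def antipode_def[of x] add.commute cong: if_cong)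
  qed
  ultimately show ?thesis
    by (intro enat_le_coindI[where f = f]) (simp add: odd_map_def VR_sphere_def)
qed

section \<open>Large families of nearly orthogonal vectors\<close>

lemma exp_plus_exp_uminus_le: "exp x + exp (- x) \<le> 2 * exp (x\<^sup>2)" for x :: real
proof -
  have main: "exp x + exp (- x) \<le> 2 * exp (x\<^sup>2)" if "x \<ge> 0" for x :: real
  proof (cases "x \<le> 1")
    case True
    have "exp x \<le> 1 + x + x\<^sup>2" using that True by (rule exp_bound)
    moreover have "exp (- x) \<le> 1 - x + x\<^sup>2"
    proof -
      have "1 \<le> 1 + x ^ 3" using that by simp
      also have "\<dots> = (1 - x + x\<^sup>2) * (1 + x)" by (simp add: algebra_simps power2_eq_square power3_eq_cube)
      also have "\<dots> \<le> (1 - x + x\<^sup>2) * exp x"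
        using True exp_ge_add_one_self[of x] by (intro mult_left_mono) auto
      finally show ?thesis by (simp add: exp_minus field_simps)
    qed
    ultimately have "exp x + exp (- x) \<le> 2 * (1 + x\<^sup>2)" by simp
    also have "\<dots> \<le> 2 * exp (x\<^sup>2)" by (intro mult_left_mono exp_ge_add_one_self) simp
    finally show ?thesis .
  next
    case False
    then have "x \<le> x\<^sup>2" "- x \<le> x\<^sup>2"
      by (auto simp: power2_eq_square mult_le_cancel_left1 intro: order_trans[of _ 0])
    then have "exp x \<le> exp (x\<^sup>2)" "exp (- x) \<le> exp (x\<^sup>2)" by simp_all
    then show ?thesis by linarith
  qed
  show ?thesis using main[of x] main[of "- x"] by (cases "x \<ge> 0") (simp_all add: add.commute)
qed

text \<open>
  The averages of \<open>exp (\<Sum>j<m. \<epsilon> j * p i j)\<close> over all signs are products of hyperbolic cosines, hence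
  at most the exponentials on the right; some choice of signs does as well as the average.
  The proof fixes the signs one at a time, and the weights \<open>a\<close> absorb the factors that belong to
  the coordinates already estimated.
\<close>
lemma exists_signs_exp_sum_le:
  fixes a :: "'i \<Rightarrow> real" and p :: "'i \<Rightarrow> nat \<Rightarrow> real"
  assumes "\<And>i. i \<in> I \<Longrightarrow> 0 \<le> a i"
  shows "\<exists>\<epsilon>. (\<forall>j<m. \<epsilon> j = 1 \<or> \<epsilon> j = -1) \<and>
    (\<Sum>i\<in>I. a i * exp (\<Sum>j<m. \<epsilon> j * p i j)) \<le> (\<Sum>i\<in>I. a i * exp (\<Sum>j<m. (p i j)\<^sup>2))"
  using assms
proof (induction m arbitrary: a)
  case (Suc m)
  obtain \<epsilon> :: "nat \<Rightarrow> real" where \<epsilon>: "\<forall>j<m. \<epsilon> j = 1 \<or> \<epsilon> j = -1"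
    and le: "(\<Sum>i\<in>I. a i * exp ((p i m)\<^sup>2) * exp (\<Sum>j<m. \<epsilon> j * p i j)) \<le>
       (\<Sum>i\<in>I. a i * exp ((p i m)\<^sup>2) * exp (\<Sum>j<m. (p i j)\<^sup>2))"
    using Suc.IH[of "\<lambda>i. a i * exp ((p i m)\<^sup>2)"] Suc.prems by auto
  define T where "T = (\<lambda>s. \<Sum>i\<in>I. a i * exp ((\<Sum>j<m. \<epsilon> j * p i j) + s * p i m))"
  have "T 1 + T (- 1) = (\<Sum>i\<in>I. a i * exp (\<Sum>j<m. \<epsilon> j * p i j) * (exp (p i m) + exp (- p i m)))"
    by (simp add: T_def exp_add sum.distrib algebra_simps)
  also have "\<dots> \<le> (\<Sum>i\<in>I. a i * exp (\<Sum>j<m. \<epsilon> j * p i j) * (2 * exp ((p i m)\<^sup>2)))"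
    using Suc.prems by (intro sum_mono mult_left_mono exp_plus_exp_uminus_le) auto
  also have "\<dots> = 2 * (\<Sum>i\<in>I. a i * exp ((p i m)\<^sup>2) * exp (\<Sum>j<m. \<epsilon> j * p i j))"
    by (simp add: sum_distrib_left mult_ac)
  also have "\<dots> \<le> 2 * (\<Sum>i\<in>I. a i * exp (\<Sum>j<Suc m. (p i j)\<^sup>2))"
    using le by (simp add: exp_add mult_ac)
  finally have "T 1 \<le> (\<Sum>i\<in>I. a i * exp (\<Sum>j<Suc m. (p i j)\<^sup>2)) \<or>
      T (-1) \<le> (\<Sum>i\<in>I. a i * exp (\<Sum>j<Suc m. (p i j)\<^sup>2))"
    by linarith
  then obtain s where s: "s = 1 \<or> s = (-1::real)" "T s \<le> (\<Sum>i\<in>I. a i * exp (\<Sum>j<Suc m. (p i j)\<^sup>2))"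
    by blast
  let ?\<epsilon> = "\<epsilon>(m := s)"
  have "(\<Sum>j<Suc m. ?\<epsilon> j * p i j) = (\<Sum>j<m. \<epsilon> j * p i j) + s * p i m" for i
    by simp
  then have "(\<Sum>i\<in>I. a i * exp (\<Sum>j<Suc m. ?\<epsilon> j * p i j)) = T s"
    unfolding T_def by presburger
  moreover have "\<forall>j<Suc m. ?\<epsilon> j = 1 \<or> ?\<epsilon> j = -1"
    using \<epsilon> s(1) by (auto simp: less_Suc_eq)
  ultimately show ?case using s(2) by (intro exI[of _ ?\<epsilon>]) auto
qed auto

text \<open>
  A sign vector divided by \<open>sqrt (m+1)\<close>. A single vector \<open>v\<close> with \<open>\<bar>ip m z v\<bar> > c\<close> would contribute
  a term to the exponential sum that exceeds the bound for the whole sum.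
\<close>
lemma exists_nearly_orthogonal_to_all:
  assumes c: "0 < c" and V: "finite V" "V \<subseteq> sph m"
    and small: "2 * real (card V) < exp (c\<^sup>2 * real (m + 1) / 4)"
  obtains z where "z \<in> sph m" "\<And>v. v \<in> V \<Longrightarrow> \<bar>ip m z v\<bar> \<le> c"
proof -
  define M where "M = sqrt (real (m + 1))"
  have M: "M > 0" "M\<^sup>2 = real (m + 1)" by (simp_all add: M_def)
  \<comment> \<open>This choice of \<open>l\<close> maximizes \<open>l * (c * M) - l\<^sup>2\<close>, the exponent by which a single
    large inner product would exceed the average.\<close>
  define l where "l = c * M / 2"
  \<comment> \<open>Adding the antipodes turns the one-sided estimate below into one for absolute values.\<close>
  define V' where "V' = V \<union> antipode ` V"
  have V': "finite V'" "V' \<subseteq> sph m" using V by (auto simp: V'_def)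
  have "card V' \<le> 2 * card V"
    using card_Un_le[of V "antipode ` V"] card_image_le[OF V(1), of antipode] by (simp add: V'_def)
  then have card: "real (card V') \<le> 2 * real (card V)" by linarith
  obtain \<epsilon> :: "nat \<Rightarrow> real" where \<epsilon>: "\<forall>j<Suc m. \<epsilon> j = 1 \<or> \<epsilon> j = -1"
    and le: "(\<Sum>v\<in>V'. 1 * exp (\<Sum>j<Suc m. \<epsilon> j * (l * v j))) \<le> (\<Sum>v\<in>V'. 1 * exp (\<Sum>j<Suc m. (l * v j)\<^sup>2))"
    using exists_signs_exp_sum_le[of V' "\<lambda>_. 1" "Suc m" "\<lambda>v j. l * v j"] by auto
  have lhs: "(\<Sum>j<Suc m. \<epsilon> j * (l * v j)) = l * ip m \<epsilon> v" for v
    by (simp add: ip_def lessThan_Suc_atMost sum_distrib_left mult_ac del: sum.lessThan_Suc)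
  have rhs: "(\<Sum>j<Suc m. (l * v j)\<^sup>2) = l\<^sup>2" if "v \<in> V'" for v
  proof -
    have "(\<Sum>j<Suc m. (l * v j)\<^sup>2) = l\<^sup>2 * ip m v v"
      by (simp add: ip_def lessThan_Suc_atMost sum_distrib_left power2_eq_square mult_ac del: sum.lessThan_Suc)
    then show ?thesis using V' that by (auto simp: sph_iff)
  qed
  have upper: "ip m \<epsilon> v < c * M" if v: "v \<in> V'" for v
  proof -
    have "exp (l * ip m \<epsilon> v) \<le> (\<Sum>v\<in>V'. exp (l * ip m \<epsilon> v))"
      using v V' by (intro member_le_sum) auto
    also have "\<dots> \<le> (\<Sum>v\<in>V'. exp (l\<^sup>2))"
      using le rhs by (simp only: lhs mult_1 rhs cong: sum.cong)
    also have "\<dots> = real (card V') * exp (l\<^sup>2)" by simp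
    also have "\<dots> \<le> 2 * real (card V) * exp (l\<^sup>2)" by (intro mult_right_mono card) auto
    also have "\<dots> < exp (c\<^sup>2 * real (m + 1) / 4) * exp (l\<^sup>2)"
      by (intro mult_strict_right_mono small) auto
    also have "c\<^sup>2 * real (m + 1) / 4 = l\<^sup>2"
      unfolding l_def M(2)[symmetric] by (simp add: power2_eq_square)
    also have "exp (l\<^sup>2) * exp (l\<^sup>2) = exp (l * (c * M))"
      by (simp add: l_def power2_eq_square flip: exp_add)
    finally show ?thesis using c M(1) by (simp add: l_def)
  qed
  define z where "z = (\<lambda>j. if j \<le> m then (1 / M) * \<epsilon> j else 0)"
  have zip: "ip m z v = ip m \<epsilon> v / M" for v
  proof -
    have "ip m z v = ip m (\<lambda>j. (1 / M) * \<epsilon> j) v" by (rule ip_cong) (auto simp: z_def)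
    then show ?thesis by (simp only: ip_scale_left) simp
  qed
  show ?thesis
  proof (rule that)
    have "ip m z z = (\<Sum>j\<le>m. (1 / M)\<^sup>2)"
      unfolding ip_def
    proof (rule sum.cong)
      fix j assume "j \<in> {..m}"
      then show "z j * z j = (1 / M)\<^sup>2" using \<epsilon>[rule_format, of j] by (auto simp: z_def power2_eq_square)
    qed simp
    also have "\<dots> = 1" using M by (simp add: power_divide)
    finally show "z \<in> sph m" by (simp add: sph_iff z_def)
    fix v assume v: "v \<in> V"
    then have "ip m \<epsilon> v < c * M" "ip m \<epsilon> (antipode v) < c * M"
      using upper[of v] upper[of "antipode v"] by (auto simp: V'_def)
    then show "\<bar>ip m z v\<bar> \<le> c"
      using M(1) by (simp add: zip divide_le_eq abs_le_iff)
  qed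
qed

text \<open>
  Greedy choice: a new vector can be added as long as the family is exponentially small.
\<close>
lemma exists_nearly_orthogonal_family:
  assumes c: "0 < c" and small: "2 * real N < exp (c\<^sup>2 * real (m + 1) / 4)"
  shows "\<exists>v. (\<forall>i<N. v i \<in> sph m) \<and> (\<forall>i<N. \<forall>j<N. i \<noteq> j \<longrightarrow> \<bar>ip m (v i) (v j)\<bar> \<le> c)"
  using small
proof (induction N)
  case (Suc N)
  then have "2 * real N < exp (c\<^sup>2 * real (m + 1) / 4)" by simp
  then obtain v where v: "\<forall>i<N. v i \<in> sph m" "\<forall>i<N. \<forall>j<N. i \<noteq> j \<longrightarrow> \<bar>ip m (v i) (v j)\<bar> \<le> c"
    using Suc.IH by blast
  have "card (v ` {..<N}) \<le> N" using card_image_le[of "{..<N}" v] by simp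
  then have "2 * real (card (v ` {..<N})) \<le> 2 * real (Suc N)" by simp
  then have few: "2 * real (card (v ` {..<N})) < exp (c\<^sup>2 * real (m + 1) / 4)"
    using Suc.prems by (rule le_less_trans)
  obtain z where z: "z \<in> sph m" "\<And>w. w \<in> v ` {..<N} \<Longrightarrow> \<bar>ip m z w\<bar> \<le> c"
  proof (rule exists_nearly_orthogonal_to_all[OF c _ _ few])
    show "v ` {..<N} \<subseteq> sph m" using v(1) by blast
  qed auto
  show ?case
  proof (intro exI[of _ "v(N := z)"] conjI allI impI)
    show "(v(N := z)) i \<in> sph m" if "i < Suc N" for i
      using that v z by (auto simp: less_Suc_eq)
    show "\<bar>ip m ((v(N := z)) i) ((v(N := z)) j)\<bar> \<le> c" if "i < Suc N" "j < Suc N" "i \<noteq> j" for i j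
      using that v(2) z(2) by (auto simp: less_Suc_eq ip_commute[of m _ z])
  qed
qed auto

section \<open>The thresholds and the growth of B\<close>

lemma coind_threshold_leI:
  assumes "0 \<le> r" "enat n \<le> coind (VR_sphere m r) VR_antipode"
  shows "coind_threshold m n \<le> r"
  unfolding coind_threshold_def using assms by (intro cInf_lower) (auto intro!: bdd_belowI[of _ 0])

lemma coind_threshold_lessD:
  assumes "coind_threshold m n < r"
  obtains \<rho> where "0 \<le> \<rho>" "\<rho> < r" "enat n \<le> coind (VR_sphere m \<rho>) VR_antipode"
proof -
  have "pi \<in> {r. 0 \<le> r \<and> enat n \<le> coind (VR_sphere m r) VR_antipode}"
    by (simp add: coind_VR_pi)
  then show ?thesis
    using cInf_lessD[of "{r. 0 \<le> r \<and> enat n \<le> coind (VR_sphere m r) VR_antipode}" r] assms that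
    unfolding coind_threshold_def by blast
qed

text \<open>
  The threshold is an infimum, and the partition-of-unity maps exist at every positive scale.
\<close>
lemma coind_threshold_diagonal: "coind_threshold m m \<le> 0"
proof (rule field_le_epsilon)
  fix e :: real assume "0 < e"
  have "coind_threshold m m \<le> min e pi"
    using \<open>0 < e\<close> by (intro coind_threshold_leI coind_VR_ge_dim) auto
  then show "coind_threshold m m \<le> 0 + e" by simp
qed

text \<open>
  Strictness matters here, because the infimum need not be attained. The bound \<open>coind_VR_le_dim\<close>
  holds on a range of scales that extends beyond \<open>pi / 2\<close> by an amount depending on \<open>m\<close>.
\<close>
lemma coind_threshold_gt_half_pi:
  assumes "m < n"
  shows "coind_threshold m n > pi / 2"
proof -
  \<comment> \<open>Any scale strictly between \<open>pi / 2\<close> and \<open>arccos (- 1 / (m + 1))\<close> would do.\<close>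
  define r where "r = arccos (- 1 / real (m + 2))"
  have bounds: "-1 \<le> - 1 / real (m + 2)" "- 1 / real (m + 2) < 0"
    using divide_le_eq_1_pos[of "real (m + 2)" 1] by (auto simp: minus_le_iff simp flip: minus_divide_left)
  moreover from bounds(2) have "- 1 / real (m + 2) \<le> 1" by linarith
  ultimately have r: "r \<le> pi" "cos r = - 1 / real (m + 2)"
    unfolding r_def by (blast intro: arccos_ubound cos_arccos)+
  have r_gt: "pi / 2 < r"
    using arccos_less_mono[of 0 "- 1 / real (m + 2)"] bounds by (simp add: r_def arccos_0)
  have "r \<le> coind_threshold m n"
  proof (rule ccontr)
    assume "\<not> ?thesis"
    then obtain \<rho> where \<rho>: "0 \<le> \<rho>" "\<rho> < r" "enat n \<le> coind (VR_sphere m \<rho>) VR_antipode"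
      using coind_threshold_lessD[of m n r] by auto
    have "- 1 / real (m + 1) < cos r" unfolding r(2) by (simp add: field_simps)
    also have "\<dots> \<le> cos \<rho>" using \<rho> r by (intro cos_monotone_0_pi_le) auto
    finally have "coind (VR_sphere m \<rho>) VR_antipode \<le> enat m"
      using \<rho> r by (intro coind_VR_le_dim) auto
    with \<rho>(3) assms show False by (meson enat_ord_simps(1) leD order_trans)
  qed
  with r_gt show ?thesis by simp
qed

text \<open>
  Coindex bounds at a scale strictly between \<open>r\<close> and \<open>pi\<close> are needed, since the threshold may be
  equal to \<open>r\<close> without being attained.
\<close>
lemma finite_B_set:
  assumes "0 \<le> r" "r < pi"
  shows "finite {l. k \<le> l \<and> coind_threshold (k - 1) (l - 1) \<le> r}"
proof -
  define r' where "r' = (r + pi) / 2"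
  have r': "0 \<le> r'" "r' < pi" "r < r'" using assms by (auto simp: r'_def)
  obtain N where N: "\<And>\<rho>. \<lbrakk>0 \<le> \<rho>; \<rho> \<le> r'\<rbrakk> \<Longrightarrow> coind (VR_sphere (k - 1) \<rho>) VR_antipode \<le> enat N"
    using coind_VR_bounded[OF r'(1,2), of "k - 1"] by metis
  have "l \<le> Suc N" if l: "coind_threshold (k - 1) (l - 1) \<le> r" for l
  proof -
    obtain \<rho> where \<rho>: "0 \<le> \<rho>" "\<rho> < r'" "enat (l - 1) \<le> coind (VR_sphere (k - 1) \<rho>) VR_antipode"
      using coind_threshold_lessD[of "k - 1" "l - 1" r'] l r' by auto
    then have "enat (l - 1) \<le> enat N" using N[of \<rho>] by (meson less_imp_le order_trans)
    then show ?thesis by simp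
  qed
  then have "{l. k \<le> l \<and> coind_threshold (k - 1) (l - 1) \<le> r} \<subseteq> {..Suc N}" by auto
  then show ?thesis by (rule finite_subset) simp
qed

lemma B_eq_self:
  assumes "0 \<le> r" "r \<le> pi / 2" "k \<ge> 1"
  shows "B r k = k"
proof -
  have "l = k" if "k \<le> l" "coind_threshold (k - 1) (l - 1) \<le> r" for l
  proof (rule ccontr)
    assume "l \<noteq> k"
    then have "k - 1 < l - 1" using that assms by simp
    then show False using coind_threshold_gt_half_pi[of "k - 1" "l - 1"] that assms by simp
  qed
  moreover have "coind_threshold (k - 1) (k - 1) \<le> r"
    using coind_threshold_diagonal[of "k - 1"] assms by simp
  ultimately have "{l. k \<le> l \<and> coind_threshold (k - 1) (l - 1) \<le> r} = {k}" by auto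
  then show ?thesis by (simp add: B_def)
qed

lemma B_superlinear:
  assumes r: "pi / 2 < r" "r < pi"
  shows "\<forall>\<^sub>F k in sequentially. M * k \<le> B r k"
proof -
  define c where "c = - cos r"
  have c: "0 < c" using cos_monotone_0_pi[of "pi / 2" r] r by (simp add: c_def)
  \<comment> \<open>\<open>M'\<close> is positive, so that \<open>M' * k \<ge> k\<close>. The bound on \<open>K\<close> comes from \<open>exp y \<ge> y\<^sup>2 / 2\<close> with
    \<open>y = c\<^sup>2 * k / 4\<close>.\<close>
  define M' where "M' = Suc M"
  obtain K :: nat where K: "64 * real M' / c ^ 4 < real K"
    using reals_Archimedean2 by blast
  have "M * k \<le> B r k" if k: "k \<ge> Suc K" for k
  proof -
    define l where "l = M' * k"
    have k1: "real (k - 1 + 1) = real k" and l1: "l \<ge> 1" and kl: "k \<le> l" using k by (auto simp: l_def M'_def)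
    have "64 * real M' / c ^ 4 < real k" using K k by linarith
    then have "64 * real M' < real k * c ^ 4" using c by (simp add: divide_less_eq)
    then have "64 * real M' * real k < real k * c ^ 4 * real k"
      using k by (intro mult_strict_right_mono) auto
    then have "2 * real l < (c\<^sup>2 * real k / 4)\<^sup>2 / 2"
      by (simp add: l_def power2_eq_square power4_eq_xxxx field_simps)
    also have "\<dots> \<le> exp (c\<^sup>2 * real k / 4)"
    proof -
      have "0 \<le> c\<^sup>2 * real k / 4" by simp
      from exp_lower_Taylor_quadratic[OF this] this show ?thesis by linarith
    qed
    finally have "2 * real l < exp (c\<^sup>2 * real (k - 1 + 1) / 4)" using k1 by simp
    then obtain v where v: "\<forall>i<l. v i \<in> sph (k - 1)"
       "\<forall>i<l. \<forall>j<l. i \<noteq> j \<longrightarrow> \<bar>ip (k - 1) (v i) (v j)\<bar> \<le> c"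
      using exists_nearly_orthogonal_family[OF c] by blast
    have "enat (l - 1) \<le> coind (VR_sphere (k - 1) r) VR_antipode"
      using v l1 r by (intro coind_VR_ge_of_nearly_orthogonal[of r "l - 1" v])
        (auto simp: c_def intro: order_trans[OF _ less_imp_le])
    then have "coind_threshold (k - 1) (l - 1) \<le> r"
      using r by (intro coind_threshold_leI) (auto intro: order_trans[OF _ less_imp_le])
    then have "l \<le> B r k"
      unfolding B_def using r kl by (intro Max_ge finite_B_set) (auto intro: order_trans[OF _ less_imp_le])
    then show ?thesis by (simp add: l_def M'_def)
  qed
  then show ?thesis unfolding eventually_sequentially by blast
qed

theorem proposition6p6:
  fixes r :: real
  assumes "0 \<le> r" and "r < pi"
  shows "Lambda r = (if r \<le> pi / 2 then 1 else \<infinity>) \<and>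
    (r \<le> pi / 2 \<longrightarrow> (\<forall>k\<ge>1. B r k = k))"
proof (cases "r \<le> pi / 2")
  case True
  have B: "\<forall>k\<ge>1. B r k = k" using B_eq_self assms True by blast
  have "(\<lambda>k. ereal (real (B r k) / real k)) \<longlonglongrightarrow> 1"
  proof (rule tendsto_eventually)
    show "\<forall>\<^sub>F k in sequentially. ereal (real (B r k) / real k) = 1"
      using eventually_ge_at_top[of 1] by eventually_elim (use B in \<open>auto simp: one_ereal_def\<close>)
  qed
  then have "Lambda r = 1" unfolding Lambda_def by (rule limI)
  with B True show ?thesis by simp
next
  case False
  have "(\<lambda>k. ereal (real (B r k) / real k)) \<longlonglongrightarrow> \<infinity>"
    unfolding tendsto_PInfty
  proof
    fix x :: real
    obtain M :: nat where M: "x < real M" using reals_Archimedean2 by blast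
    have "\<forall>\<^sub>F k in sequentially. M * k \<le> B r k"
      using B_superlinear False assms by simp
    then show "\<forall>\<^sub>F k in sequentially. ereal x < ereal (real (B r k) / real k)"
      using eventually_ge_at_top[of 1]
    proof eventually_elim
      case (elim k)
      then have "real M * real k \<le> real (B r k)" by (metis of_nat_le_iff of_nat_mult)
      then have "real M \<le> real (B r k) / real k" using elim by (simp add: le_divide_eq)
      with M show ?case by simp
    qed
  qed
  then have "Lambda r = \<infinity>" unfolding Lambda_def by (rule limI)
  with False show ?thesis by simp
qed

end
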